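(* Let $r\ge2$ be an integer. There is a constant $c_r>0$ depending only on $r$ such that for every $M\ge2$, every $\chi\in\mathscr{H}_M^r$ and every $u\in\mathbb{C}^{\mathcal{T}_M}$, $$\|\nabla\chi(u)\|_{h^{1/2}}\le c_r(\log M)^{(r-1)/2}\,\|\chi\|_{\mathscr{C}}\,\|u\|_{h^{1/2}}^{r-1}$$ and $$\|\mathrm{d}\nabla\chi(u)\|_{\mathscr{L}(h^{1/2})}\le c_r(\log M)^{(r-1)/2}\,\|\chi\|_{\mathscr{C}}\,\|u\|_{h^{1/2}}^{r-2}.$$
   Context: $\mathbb{N}=\{0,1,2,\dots\}$, $\langle y\rangle=\sqrt{1+y^2}$. For $M\in(0,\infty)$, $\mathcal{T}_M=\{(\ell,m)\in\mathbb{N}\times\mathbb{Z}:0\le\ell\le M,\ -\ell\le m\le\ell\}$. $\mathbb{C}^{\mathcal{T}_M}$ is viewed as a real Euclidean space with $(u,v)_{\ell^2}=\Re\sum_{k\in\mathcal{T}_M}u_k\overline{v_k}$; $\nabla$ is the gradient for this scalar product; $\|u\|_{h^s}^2=\sum_{k=(\ell,m)\in\mathcal{T}_M}\langle\ell\rangle^{2s}|u_k|^2$; $\mathrm{d}\nabla\chi(u)$ is the (real) differential of $\nabla\chi$ at $u$ and $\|\cdot\|_{\mathscr{L}(h^s)}$ is the operator norm of real-linear endomorphisms of $(\mathbb{C}^{\mathcal{T}_M},\|\cdot\|_{h^s})$. $\mathscr{H}_M^r$ is the space of real-valued homogeneous polynomials of degree $r$ on the real vector space $\mathbb{C}^{\mathcal{T}_M}$.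 Each $\chi\in\mathscr{H}_M^r$ is uniquely written $\chi(u)=\sum_{\sigma\in\{-1,1\}^r}\sum_{\mathbf{k}\in\mathcal{T}_M^r}\chi_{\mathbf{k}}^\sigma u_{k_1}^{\sigma_1}\cdots u_{k_r}^{\sigma_r}$ (with $u_k^{1}=u_k$, $u_k^{-1}=\overline{u_k}$), where the complex coefficients satisfy $\chi_{\mathbf{k}}^{-\sigma}=\overline{\chi_{\mathbf{k}}^\sigma}$ and are invariant under simultaneous permutation of the entries of $\mathbf{k}$ and $\sigma$. With $k_j=(\ell_j,m_j)$ and $\Upsilon(\mathbf{k})=\max(\{1\}\cup\{\langle\ell_j\rangle:1\le j\le r,\ \forall j'\ne j,\ k_{j'}\ne k_j\})$, $$\|\chi\|_{\mathscr{C}}=\max_{\sigma\in\{-1,1\}^r}\max_{\mathbf{k}\in\mathcal{T}_M^r}|\chi_{\mathbf{k}}^\sigma|\,\langle\sigma_1\ell_1+\cdots+\sigma_r\ell_r\rangle\sqrt{\langle\ell_1\rangle\cdots\langle\ell_r\rangle}\sqrt{\Upsilon(\mathbf{k})}.$$ *)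

theory Defs
  imports "HOL-Analysis.Analysis" "HOL-Analysis.Finite_Function_Topology"
    "HOL-Combinatorics.Permutations"
begin

text \<open>
  The spaces \<open>\<complex>\<^sup>T\<close>, \<open>T = modes M\<close>, for all cut-offs \<open>M\<close> at once are realised as subspaces of the
  finitely supported families \<open>(nat \<times> int) \<Rightarrow>\<^sub>0 complex\<close>, a real normed space for the \<open>\<ell>\<^sup>1\<close> norm.
  Each of them is finite-dimensional, so that polynomial functions and derivatives
  within \<open>seqs M\<close> do not depend on this choice of norm.
\<close>

type_synonym mode = "nat \<times> int"
type_synonym cseq = "mode \<Rightarrow>\<^sub>0 complex"

definition jap :: "real \<Rightarrow> real" where
  "jap y = sqrt (1 + y\<^sup>2)"

definition modes :: "real \<Rightarrow> mode set" where
  "modes M = {(l, m). real l \<le> M \<and> - int l \<le> m \<and> m \<le> int l}"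

definition seqs :: "real \<Rightarrow> cseq set" where
  "seqs M = {u. Poly_Mapping.keys u \<subseteq> modes M}"

definition scal :: "real \<Rightarrow> cseq \<Rightarrow> cseq \<Rightarrow> real" where
  "scal M u v =
     Re (\<Sum>k\<in>modes M. Poly_Mapping.lookup u k * cnj (Poly_Mapping.lookup v k))"

definition hnorm :: "real \<Rightarrow> real \<Rightarrow> cseq \<Rightarrow> real" where
  "hnorm M s u =
     sqrt (\<Sum>k\<in>modes M. jap (real (fst k)) powr (2 * s) * (cmod (Poly_Mapping.lookup u k))\<^sup>2)"

text \<open>Same convention as \<^const>\<open>onorm\<close>: the vector \<open>0\<close> contributes the quotient \<open>0 / 0 = 0\<close>.\<close>

definition hopnorm :: "real \<Rightarrow> real \<Rightarrow> (cseq \<Rightarrow> cseq) \<Rightarrow> real" where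
  "hopnorm M s L = (SUP v\<in>seqs M. hnorm M s (L v) / hnorm M s v)"

text \<open>
  Only the values of \<open>chi\<close> on \<open>seqs M\<close> matter, here and below.
\<close>

definition homog_polys :: "real \<Rightarrow> nat \<Rightarrow> (cseq \<Rightarrow> real) set" where
  "homog_polys M r =
     {chi. (\<exists>p. real_polynomial_function p \<and> (\<forall>u\<in>seqs M. chi u = p u)) \<and>
         (\<forall>t. \<forall>u\<in>seqs M. chi (t *\<^sub>R u) = t ^ r * chi u)}"

definition nabla :: "real \<Rightarrow> (cseq \<Rightarrow> real) \<Rightarrow> cseq \<Rightarrow> cseq" where
  "nabla M chi u =
     (THE g. g \<in> seqs M \<and> (chi has_derivative (\<lambda>h. scal M g h)) (at u within seqs M))"

text \<open>
  \<^const>\<open>frechet_derivative\<close> picks some derivative within \<open>seqs M\<close>; it is determined on \<open>seqs M\<close>,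
  and \<^const>\<open>hopnorm\<close> only looks at its values there.
\<close>

definition dnabla :: "real \<Rightarrow> (cseq \<Rightarrow> real) \<Rightarrow> cseq \<Rightarrow> cseq \<Rightarrow> cseq" where
  "dnabla M chi u = frechet_derivative (nabla M chi) (at u within seqs M)"

definition sgns :: "nat \<Rightarrow> (nat \<Rightarrow> int) set" where
  "sgns r = {..<r} \<rightarrow>\<^sub>E {- 1, 1}"

definition tuples :: "real \<Rightarrow> nat \<Rightarrow> (nat \<Rightarrow> mode) set" where
  "tuples M r = {..<r} \<rightarrow>\<^sub>E modes M"

definition conj_pow :: "complex \<Rightarrow> int \<Rightarrow> complex" where
  "conj_pow z s = (if s = 1 then z else cnj z)"

text \<open>Coefficients are extended by \<open>0\<close> outside their index set, so that they are unique as functions.\<close>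

definition is_coeffs ::
  "real \<Rightarrow> nat \<Rightarrow> (cseq \<Rightarrow> real) \<Rightarrow> ((nat \<Rightarrow> int) \<Rightarrow> (nat \<Rightarrow> mode) \<Rightarrow> complex) \<Rightarrow> bool" where
  "is_coeffs M r chi c \<longleftrightarrow>
     (\<forall>u\<in>seqs M. complex_of_real (chi u) =
        (\<Sum>\<sigma>\<in>sgns r. \<Sum>k\<in>tuples M r.
           c \<sigma> k * (\<Prod>j<r. conj_pow (Poly_Mapping.lookup u (k j)) (\<sigma> j)))) \<and>
     (\<forall>\<sigma>\<in>sgns r. \<forall>k\<in>tuples M r. c (\<lambda>j\<in>{..<r}. - \<sigma> j) k = cnj (c \<sigma> k)) \<and>
     (\<forall>\<sigma>\<in>sgns r. \<forall>k\<in>tuples M r. \<forall>\<pi>. \<pi> permutes {..<r} \<longrightarrow> c (\<sigma> \<circ> \<pi>) (k \<circ> \<pi>) = c \<sigma> k) \<and>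
     (\<forall>\<sigma> k. \<sigma> \<notin> sgns r \<or> k \<notin> tuples M r \<longrightarrow> c \<sigma> k = 0)"

definition coeffs ::
  "real \<Rightarrow> nat \<Rightarrow> (cseq \<Rightarrow> real) \<Rightarrow> (nat \<Rightarrow> int) \<Rightarrow> (nat \<Rightarrow> mode) \<Rightarrow> complex" where
  "coeffs M r chi = (THE c. is_coeffs M r chi c)"

definition Upsilon :: "nat \<Rightarrow> (nat \<Rightarrow> mode) \<Rightarrow> real" where
  "Upsilon r k =
     Max ({1} \<union> {jap (real (fst (k j))) | j. j < r \<and> (\<forall>j'<r. j' \<noteq> j \<longrightarrow> k j' \<noteq> k j)})"

definition Cnorm :: "real \<Rightarrow> nat \<Rightarrow> (cseq \<Rightarrow> real) \<Rightarrow> real" where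
  "Cnorm M r chi =
     Max ((\<lambda>(\<sigma>, k). cmod (coeffs M r chi \<sigma> k)
            * jap (\<Sum>j<r. real_of_int (\<sigma> j) * real (fst (k j)))
            * sqrt (\<Prod>j<r. jap (real (fst (k j))))
            * sqrt (Upsilon r k)) ` (sgns r \<times> tuples M r))"

end

theory Submission
  imports Defs
begin

text \<open>
  Write \<open>\<chi>(u) = F(u, \<dots>, u)\<close> with the real multilinear form \<open>F\<close> built from the coefficients of \<open>\<chi>\<close>.
  Then \<open>(\<nabla>\<chi>(u), h)\<close> is a sum of terms in which one slot of \<open>F\<close> contains \<open>h\<close> and the others
  contain \<open>u\<close>, and \<open>(d\<nabla>\<chi>(u) v, h)\<close> is a sum of terms in which one further slot contains \<open>v\<close>. As
  \<open>h^(-1/2)\<close> is dual to \<open>h^(1/2)\<close> (lemma \<open>hnorm_half_le_dual\<close>), both inequalities follow once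
  \<open>|F(w\<^sub>1, \<dots>, w\<^sub>r)|\<close> is bounded by a constant times \<open>(log M)^((r-1)/2) \<parallel>\<chi>\<parallel>\<close>, times the norm of \<open>w\<^sub>i\<close> in
  \<open>h^(-1/2)\<close> and the norms of all other \<open>w\<^sub>j\<close> in \<open>h^(1/2)\<close>. This is lemma \<open>cmod_mform_le\<close>.

  To prove it, insert the bound on the coefficients and absorb the weights into the arguments. What is
  left is the sum over all tuples \<open>k\<close> of modes of
  \<open>a(k\<^sub>i) (\<Prod>j\<noteq>i. b\<^sub>j(k\<^sub>j) / \<langle>\<ell>\<^sub>j\<rangle>) / (\<langle>\<sigma>\<^sub>1 \<ell>\<^sub>1 + \<dots> + \<sigma>\<^sub>r \<ell>\<^sub>r\<rangle> \<surd>\<Upsilon>(k))\<close>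
  with families \<open>a\<close> and \<open>b\<^sub>j\<close> in \<open>\<ell>\<^sup>2\<close> (lemma \<open>weighted_sum_le\<close>). A factor \<open>j \<noteq> i\<close> alone costs
  \<open>(\<Sum>k. 1 / \<langle>\<ell>\<rangle>\<^sup>2)^(1/2)\<close>, that is \<open>(log M)^(1/2)\<close>. If the mode of slot \<open>i\<close> is isolated then
  \<open>\<Upsilon> \<ge> \<langle>\<ell>\<^sub>i\<rangle>\<close>, which compensates the multiplicity \<open>2 \<ell>\<^sub>i + 1\<close> of the degree \<open>\<ell>\<^sub>i\<close>; the sum
  over slot \<open>i\<close> is then bounded by square summability of \<open>1 / \<langle>n\<rangle>\<close> over the integers \<open>n\<close>. If it is not
  isolated then it equals the mode of another slot, and these two slots together form a scalar product of
  \<open>\<ell>\<^sup>2\<close>, at no cost. In both cases at most \<open>r - 1\<close> slots cost \<open>(log M)^(1/2)\<close>.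

  The remaining work is to see that the objects in the statement are the expected ones. The coefficients
  exist and are unique: a homogeneous polynomial function is a form (\<open>homog_polys_is_form\<close>), its
  coefficients can be symmetrized (\<open>is_coeffs_exists\<close>), and symmetric coefficients of the zero polynomial
  vanish by polarization (\<open>mform_polarize\<close>, \<open>coeffs_eq_zero\<close>). Derivatives within the subspace
  \<open>seqs M\<close> are unique on it, so that the gradient and its differential are the Riesz representatives of the
  explicit sums above (\<open>nabla_eq_riesz\<close>, \<open>dnabla_eq_riesz\<close>).
\<close>

section \<open>Sums over the lattice of modes\<close>

lemma jap_pos: "jap y > 0"
  by (simp add: jap_def add_pos_nonneg)

lemma jap_ge_1: "jap y \<ge> 1"
  by (simp add: jap_def)

lemma jap_squared: "(jap y)\<^sup>2 = 1 + y\<^sup>2"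
  by (simp add: jap_def)

lemma finite_modes: "finite (modes M)"
proof -
  have "modes M \<subseteq> (SIGMA l:{..nat \<lfloor>M\<rfloor>}. {- int l..int l})"
    by (auto simp: modes_def le_nat_floor)
  then show ?thesis
    by (rule finite_subset) auto
qed

lemma finite_sgns: "finite (sgns r)" and finite_tuples: "finite (tuples M r)"
  by (auto simp: sgns_def tuples_def finite_modes intro: finite_PiE)

lemma sum_modes_by_degree:
  fixes f :: "nat \<Rightarrow> real"
  assumes "M \<ge> 0"
  shows "(\<Sum>k\<in>modes M. f (fst k)) = (\<Sum>l\<le>nat \<lfloor>M\<rfloor>. (2 * real l + 1) * f l)"
proof -
  have "modes M = (SIGMA l:{..nat \<lfloor>M\<rfloor>}. {- int l..int l})"
    using assms by (auto simp: modes_def le_nat_floor le_floor_iff) (simp add: le_nat_iff le_floor_iff)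
  then have "(\<Sum>k\<in>modes M. f (fst k)) = (\<Sum>l\<le>nat \<lfloor>M\<rfloor>. \<Sum>m\<in>{- int l..int l}. f l)"
    by (subst sum.Sigma) (auto simp: case_prod_unfold)
  then show ?thesis
    by (simp add: algebra_simps)
qed

lemma sum_inverse_Suc_le_ln: "(\<Sum>l\<le>n. 1 / (real l + 1)) \<le> 1 + ln (real n + 1)"
proof (induction n)
  case (Suc n)
  have "ln ((real n + 1) / (real n + 2)) \<le> (real n + 1) / (real n + 2) - 1"
    by (rule ln_le_minus_one) auto
  also have "\<dots> = - 1 / (real n + 2)"
    by (simp add: field_simps)
  finally have "1 / (real n + 2) \<le> ln (real n + 2) - ln (real n + 1)"
    by (simp add: ln_div)
  with Suc show ?case
    by (simp add: add.commute)
qed simp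

text \<open>
  The degree \<open>l\<close> carries \<open>2 l + 1\<close> modes, so this is a harmonic sum up to \<open>M\<close>. It is the only
  source of logarithms in the final estimate.
\<close>

lemma sum_modes_inverse_jap_squared_le:
  assumes "M \<ge> 2"
  shows "(\<Sum>k\<in>modes M. 1 / (jap (real (fst k)))\<^sup>2) \<le> 12 * ln M"
proof -
  define N where "N = nat \<lfloor>M\<rfloor>"
  \<comment> \<open>After clearing denominators this is \<open>0 \<le> (l - 1) (l - 2)\<close>, which holds at every integer \<open>l\<close>
    but fails between 1 and 2.\<close>
  have "(2 * real l + 1) * (1 / (1 + (real l)\<^sup>2)) \<le> 3 * (1 / (real l + 1))" for l :: nat
  proof -
    have "0 \<le> (real l - 1) * (real l - 2)"
      by (cases "l \<le> 1") (auto simp: mult_nonpos_nonpos)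
    then have "(2 * real l + 1) * (real l + 1) \<le> 3 * (1 + (real l)\<^sup>2)"
      by (simp add: algebra_simps power2_eq_square)
    then show ?thesis
      by (simp add: divide_simps add_pos_nonneg)
  qed
  then have "(\<Sum>k\<in>modes M. 1 / (jap (real (fst k)))\<^sup>2) \<le> (\<Sum>l\<le>N. 3 * (1 / (real l + 1)))"
    using assms
    by (subst sum_modes_by_degree) (auto simp: N_def jap_squared simp del: times_divide_eq_right intro!: sum_mono)
  also have "\<dots> \<le> 3 * (1 + ln (real N + 1))"
    using sum_inverse_Suc_le_ln [of N] by (subst sum_distrib_left [symmetric]) simp
  also have "\<dots> \<le> 3 * (1 + ln (M\<^sup>2))"
  proof -
    have "real N \<le> M"
      using assms by (simp add: N_def)
    moreover have "M + 1 \<le> M\<^sup>2"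
    proof -
      have "2 * M \<le> M * M"
        using assms by (intro mult_right_mono) auto
      then show ?thesis
        using assms by (simp only: power2_eq_square)
    qed
    ultimately have "ln (real N + 1) \<le> ln (M\<^sup>2)"
      by (intro ln_mono) auto
    then show ?thesis by simp
  qed
  also have "\<dots> = 3 + 6 * ln M"
    using assms by (simp add: ln_realpow)
  also have "\<dots> \<le> 12 * ln M"
  proof -
    have "ln 2 \<le> ln M" using assms by (intro ln_mono) auto
    then show ?thesis using ln2_ge_two_thirds by linarith
  qed
  finally show ?thesis .
qed

text \<open>
  For natural \<open>n\<close> the summand is at most \<open>3 / ((n + 1) (n + 2))\<close>, which telescopes to 3, and the two
  signs double the sum. This bound, uniform in \<open>S\<close>, is what makes the resonance factor \<open>1 / \<langle>\<sigma>\<^sub>1 \<ell>\<^sub>1 + \<dots>\<rangle>\<close> sum to a constant free of \<open>M\<close>.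
\<close>

lemma sum_int_inverse_jap_squared_le:
  assumes "finite (S :: int set)"
  shows "(\<Sum>p\<in>S. 1 / (jap (real_of_int p))\<^sup>2) \<le> 6"
proof -
  let ?f = "\<lambda>n. 1 / (1 + (real n)\<^sup>2)"
  have nat_sum: "(\<Sum>n<N. ?f n) \<le> 3 - 3 / (real N + 1)" for N
  proof (induction N)
    case (Suc N)
    have "0 \<le> (2 * real N - 1) * (real N - 1)"
      by (cases N) auto
    then have "(real N + 1) * (real N + 2) \<le> 3 * (1 + (real N)\<^sup>2)"
      by (simp add: algebra_simps power2_eq_square)
    then have "?f N \<le> 3 / ((real N + 1) * (real N + 2))"
      by (simp add: divide_simps add_pos_nonneg)
    also have "\<dots> = 3 / (real N + 1) - 3 / (real N + 2)"
      by (simp add: field_simps)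
    finally show ?case using Suc by (simp add: add.commute)
  qed simp
  obtain N where N: "S \<subseteq> int ` {..<N} \<union> (\<lambda>n. - int n) ` {..<N}"
  proof
    let ?N = "Suc (Max (insert 0 ((\<lambda>p. nat \<bar>p\<bar>) ` S)))"
    show "S \<subseteq> int ` {..<?N} \<union> (\<lambda>n. - int n) ` {..<?N}"
    proof
      fix p assume "p \<in> S"
      then have "nat \<bar>p\<bar> < ?N"
        using assms by (simp add: less_Suc_eq_le del: nat_le_iff)
      then show "p \<in> int ` {..<?N} \<union> (\<lambda>n. - int n) ` {..<?N}"
        by (cases "p \<ge> 0") (auto simp del: insert_iff intro: image_eqI [where x = "nat \<bar>p\<bar>"])
    qed
  qed
  have "(\<Sum>p\<in>S. 1 / (jap (real_of_int p))\<^sup>2)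
      \<le> (\<Sum>p\<in>int ` {..<N} \<union> (\<lambda>n. - int n) ` {..<N}. 1 / (jap (real_of_int p))\<^sup>2)"
    using N by (intro sum_mono2) auto
  also have "\<dots> \<le> (\<Sum>p\<in>int ` {..<N}. 1 / (jap (real_of_int p))\<^sup>2)
      + (\<Sum>p\<in>(\<lambda>n. - int n) ` {..<N}. 1 / (jap (real_of_int p))\<^sup>2)"
    by (subst sum.union_inter [symmetric]) (auto intro!: sum_nonneg)
  also have "\<dots> = 2 * (\<Sum>n<N. ?f n)"
    by (simp add: sum.reindex inj_on_def jap_squared)
  also have "\<dots> \<le> 6"
    using nat_sum [of N] by (smt (verit) divide_nonneg_nonneg of_nat_0_le_iff)
  finally show ?thesis .
qed

section \<open>The weighted sum over tuples of modes\<close>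

abbreviation wt :: "mode \<Rightarrow> real" where
  "wt k \<equiv> jap (real (fst k))"

lemma jap_nonneg [simp]: "0 \<le> jap y" and jap_nonzero [simp]: "jap y \<noteq> 0"
  using jap_pos [of y] by auto

lemma sum_PiE_split_slot:
  assumes "i \<in> A"
  shows "(\<Sum>k\<in>A \<rightarrow>\<^sub>E B. f k) = (\<Sum>k\<in>(A - {i}) \<rightarrow>\<^sub>E B. \<Sum>m\<in>B. f (k(i := m)))"
proof -
  have "(\<Sum>k\<in>A \<rightarrow>\<^sub>E B. f k) = (\<Sum>k\<in>insert i (A - {i}) \<rightarrow>\<^sub>E B. f k)"
    using assms by (simp add: insert_absorb)
  also have "\<dots> = (\<Sum>(m, k)\<in>B \<times> ((A - {i}) \<rightarrow>\<^sub>E B). f (k(i := m)))"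
    unfolding PiE_insert_eq
    by (subst sum.reindex) (auto intro!: inj_combinator sum.cong)
  also have "\<dots> = (\<Sum>m\<in>B. \<Sum>k\<in>(A - {i}) \<rightarrow>\<^sub>E B. f (k(i := m)))"
    by (rule sum.cartesian_product [symmetric])
  finally show ?thesis
    by (subst sum.swap)
qed

lemma sum_mult_le_L2_set:
  assumes "\<And>k. k \<in> A \<Longrightarrow> 0 \<le> f k" "\<And>k. k \<in> A \<Longrightarrow> 0 \<le> g k"
  shows "(\<Sum>k\<in>A. f k * g k) \<le> L2_set f A * L2_set g A"
  using L2_set_mult_ineq [of f g A] assms by (simp cong: sum.cong)

text \<open>
  The cost of summing one ordinary slot: a factor \<open>\<surd>(ln M)\<close>, by Cauchy-Schwarz.
\<close>

lemma sum_over_wt_le: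
  assumes "M \<ge> 2" "\<And>k. 0 \<le> b k"
  shows "(\<Sum>k\<in>modes M. b k / wt k) \<le> sqrt (12 * ln M) * L2_set b (modes M)"
proof -
  have "(\<Sum>k\<in>modes M. b k / wt k) \<le> L2_set b (modes M) * L2_set (\<lambda>k. 1 / wt k) (modes M)"
    using sum_mult_le_L2_set [of "modes M" b "\<lambda>k. 1 / wt k"] assms by simp
  also have "\<dots> \<le> L2_set b (modes M) * sqrt (12 * ln M)"
    using sum_modes_inverse_jap_squared_le [OF assms(1)]
    by (intro mult_left_mono) (simp_all add: L2_set_def power_divide sum_nonneg)
  finally show ?thesis
    by (simp only: mult.commute)
qed

text \<open>
  The cost of summing the distinguished slot: no logarithm. After Cauchy-Schwarz the weight
  \<open>1 / \<langle>\<ell>\<rangle>\<close> absorbs the multiplicity \<open>2 \<ell> + 1\<close>, and \<open>\<ell> \<mapsto> s \<ell> + q\<close> is injective, so that the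
  resonance factor is square summable uniformly in \<open>q\<close>. The constant is \<open>5 \<ge> \<surd>(3 \<sqdot> 6)\<close>.
\<close>

lemma sum_over_resonance_le:
  assumes "M \<ge> 0" "s \<in> {- 1, 1}" "\<And>k. 0 \<le> a k"
  shows "(\<Sum>k\<in>modes M. a k / (jap (real_of_int (s * int (fst k) + q)) * sqrt (wt k)))
    \<le> 5 * L2_set a (modes M)"
proof -
  define d where "d k = 1 / (jap (real_of_int (s * int (fst k) + q)) * sqrt (wt k))" for k :: mode
  define S where "S = (\<lambda>l. s * int l + q) ` {..nat \<lfloor>M\<rfloor>}"
  have inj: "inj_on (\<lambda>l. s * int l + q) {..nat \<lfloor>M\<rfloor>}"
    using assms(2) by (auto simp: inj_on_def)
  have "(\<Sum>k\<in>modes M. (d k)\<^sup>2)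
      = (\<Sum>l\<le>nat \<lfloor>M\<rfloor>. (2 * real l + 1) * (1 / ((jap (real_of_int (s * int l + q)))\<^sup>2 * jap (real l))))"
    using assms(1)
    by (subst sum_modes_by_degree [symmetric]) (auto simp: d_def power_divide power_mult_distrib)
  also have "\<dots> \<le> (\<Sum>l\<le>nat \<lfloor>M\<rfloor>. 3 * (1 / (jap (real_of_int (s * int l + q)))\<^sup>2))"
  proof (intro sum_mono)
    fix l :: nat
    have "real l \<le> jap (real l)"
      unfolding jap_def by (rule real_le_rsqrt) simp
    then have "2 * real l + 1 \<le> 3 * jap (real l)"
      using jap_ge_1 [of "real l"] by linarith
    then have "(2 * real l + 1) / jap (real l) \<le> 3"
      using jap_pos [of "real l"] by (simp add: divide_le_eq)
    then have "(2 * real l + 1) / jap (real l) * (1 / (jap (real_of_int (s * int l + q)))\<^sup>2)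
        \<le> 3 * (1 / (jap (real_of_int (s * int l + q)))\<^sup>2)"
      by (rule mult_right_mono) simp
    then show "(2 * real l + 1) * (1 / ((jap (real_of_int (s * int l + q)))\<^sup>2 * jap (real l)))
        \<le> 3 * (1 / (jap (real_of_int (s * int l + q)))\<^sup>2)"
      by (simp only: times_divide_eq_left times_divide_eq_right mult_1_right mult_1_left divide_divide_eq_left mult.commute)
  qed
  also have "\<dots> = 3 * (\<Sum>p\<in>S. 1 / (jap (real_of_int p))\<^sup>2)"
    unfolding S_def sum.reindex [OF inj] by (simp add: sum_distrib_left)
  also have "\<dots> \<le> 5\<^sup>2"
    using sum_int_inverse_jap_squared_le [of S] by (simp add: S_def)
  finally have "L2_set d (modes M) \<le> 5"
    unfolding L2_set_def by (intro real_le_lsqrt) (auto intro: sum_nonneg)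
  then have "L2_set a (modes M) * L2_set d (modes M) \<le> L2_set a (modes M) * 5"
    by (intro mult_left_mono) auto
  moreover have "(\<Sum>k\<in>modes M. a k * d k) \<le> L2_set a (modes M) * L2_set d (modes M)"
    using assms by (intro sum_mult_le_L2_set) (auto simp: d_def)
  ultimately show ?thesis
    by (simp add: d_def)
qed

lemma Upsilon_ge_1: "1 \<le> Upsilon r k"
  and Upsilon_ge_isolated: "j < r \<Longrightarrow> (\<And>i. i < r \<Longrightarrow> i \<noteq> j \<Longrightarrow> k i \<noteq> k j) \<Longrightarrow> wt (k j) \<le> Upsilon r k"
proof -
  have "finite {wt (k j) | j. j < r \<and> (\<forall>i<r. i \<noteq> j \<longrightarrow> k i \<noteq> k j)}"
    by (rule finite_subset [of _ "(\<lambda>j. wt (k j)) ` {..<r}"]) auto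
  then show "1 \<le> Upsilon r k"
    and "j < r \<Longrightarrow> (\<And>i. i < r \<Longrightarrow> i \<noteq> j \<Longrightarrow> k i \<noteq> k j) \<Longrightarrow> wt (k j) \<le> Upsilon r k"
    unfolding Upsilon_def by (auto intro!: Max_ge)
qed

text \<open>
  The role of \<open>\<Upsilon>\<close>. Either the mode of slot \<open>j0\<close> occurs in no other slot, and then \<open>\<Upsilon>\<close> is at
  least its weight, or it is repeated, and then one of the indicators on the right is 1 while the
  left-hand side never exceeds 1.
\<close>

lemma resonance_weight_le:
  assumes "j0 < r"
  shows "1 / (jap y * sqrt (Upsilon r k))
    \<le> 1 / (jap y * sqrt (wt (k j0))) + (\<Sum>i\<in>{..<r} - {j0}. of_bool (k i = k j0))"
proof (cases "\<exists>i<r. i \<noteq> j0 \<and> k i = k j0")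
  case True
  then obtain i where i: "i \<in> {..<r} - {j0}" "k i = k j0" by auto
  have "1 \<le> jap y * sqrt (Upsilon r k)"
    using mult_mono [of 1 "jap y" 1 "sqrt (Upsilon r k)"] jap_ge_1 [of y] Upsilon_ge_1 [of r k]
    by simp
  then have "1 / (jap y * sqrt (Upsilon r k)) \<le> 1"
    by simp
  also have "1 = (of_bool (k i = k j0) :: real)"
    using i by simp
  also have "\<dots> \<le> (\<Sum>i\<in>{..<r} - {j0}. of_bool (k i = k j0))"
    using i(1) by (intro member_le_sum) auto
  finally show ?thesis by (simp add: add_increasing)
next
  case False
  then have "wt (k j0) \<le> Upsilon r k"
    using assms by (intro Upsilon_ge_isolated) auto
  moreover have "0 < wt (k j0)" "0 < jap y"
    by (rule jap_pos)+
  ultimately have "1 / (jap y * sqrt (Upsilon r k)) \<le> 1 / (jap y * sqrt (wt (k j0)))"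
    by (intro divide_left_mono mult_left_mono) auto
  then show ?thesis
    by (simp add: add_increasing2 sum_nonneg)
qed

text \<open>
  The analytic core. Summing over the mode of slot \<open>j0\<close> first, an isolated mode is controlled by the
  resonance factor, whereas a mode repeated in slot \<open>i\<close> merges these two slots into one
  inner product of \<open>a\<close> and \<open>b i\<close>. Every other slot costs \<open>\<surd>(12 ln M)\<close>. In the constant, 5 stands
  for the isolated mode and \<open>r\<close> for the choices of \<open>i\<close>.
\<close>

lemma weighted_sum_le:
  assumes M: "M \<ge> 2" and j0: "j0 < r" and \<sigma>: "\<sigma> j0 \<in> {- 1, 1 :: int}"
    and a: "\<And>k. 0 \<le> a k" and b: "\<And>j k. 0 \<le> b j k"
  shows "(\<Sum>k\<in>tuples M r. a (k j0) * (\<Prod>j\<in>{..<r} - {j0}. b j (k j) / wt (k j))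
           * (1 / (jap (\<Sum>j<r. real_of_int (\<sigma> j) * real (fst (k j))) * sqrt (Upsilon r k))))
    \<le> (5 + real r) * L2_set a (modes M)
        * (\<Prod>j\<in>{..<r} - {j0}. sqrt (12 * ln M) * L2_set (b j) (modes M))"
proof -
  define A where "A = {..<r} - {j0}"
  define B where "B k = (\<Prod>j\<in>A. b j (k j) / wt (k j))" for k :: "nat \<Rightarrow> mode"
  define J where "J k = jap (\<Sum>j<r. real_of_int (\<sigma> j) * real (fst (k j)))" for k :: "nat \<Rightarrow> mode"
  define L where "L = sqrt (12 * ln M)"
  define P where "P = (\<Prod>j\<in>A. L * L2_set (b j) (modes M))"
  have "ln 2 \<le> ln M" using M by (intro ln_mono) auto
  then have L: "1 \<le> L"
    using ln2_ge_two_thirds by (simp add: L_def)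
  have "finite A" by (simp add: A_def)
  have B_upd: "B (k(j0 := m)) = B k" for k m
    unfolding B_def by (intro prod.cong) (auto simp: A_def)
  have B_nonneg: "0 \<le> B k" for k
    unfolding B_def by (intro prod_nonneg) (auto simp: b)
  have P_nonneg: "0 \<le> P"
    unfolding P_def using L by (intro prod_nonneg) auto
  have split: "(\<Sum>k\<in>tuples M r. f k) = (\<Sum>k\<in>A \<rightarrow>\<^sub>E modes M. \<Sum>m\<in>modes M. f (k(j0 := m)))"
    for f :: "(nat \<Rightarrow> mode) \<Rightarrow> real"
    unfolding tuples_def A_def using j0 by (intro sum_PiE_split_slot) simp
  have sum_B: "(\<Sum>k\<in>A \<rightarrow>\<^sub>E modes M. B k) \<le> P"
  proof -
    have "(\<Sum>k\<in>A \<rightarrow>\<^sub>E modes M. B k) = (\<Prod>j\<in>A. \<Sum>m\<in>modes M. b j m / wt m)"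
      unfolding B_def using \<open>finite A\<close> by (subst prod_sum_PiE) (auto simp: finite_modes)
    also have "\<dots> \<le> P"
      unfolding P_def L_def
      by (intro prod_mono conjI sum_over_wt_le M b sum_nonneg) (auto simp: b)
    finally show ?thesis .
  qed
  \<comment> \<open>For fixed modes in the other slots, their signed degrees sum to a constant \<open>q\<close>, which only
    translates the resonance factor.\<close>
  have isolated: "(\<Sum>k\<in>tuples M r. a (k j0) * B k * (1 / (J k * sqrt (wt (k j0)))))
      \<le> 5 * L2_set a (modes M) * P"
  proof -
    have "(\<Sum>m\<in>modes M. a m * B k * (1 / (J (k(j0 := m)) * sqrt (wt m))))
        \<le> B k * (5 * L2_set a (modes M))" for k
    proof -
      define q where "q = (\<Sum>j\<in>A. \<sigma> j * int (fst (k j)))"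
      have "J (k(j0 := m)) = jap (real_of_int (\<sigma> j0 * int (fst m) + q))" for m
      proof -
        have "(\<Sum>j\<in>A. real_of_int (\<sigma> j) * real (fst ((k(j0 := m)) j))) = real_of_int q"
          unfolding q_def of_int_sum by (intro sum.cong) (auto simp: A_def)
        then show ?thesis
          unfolding J_def using j0 by (simp add: sum.remove [of "{..<r}" j0] A_def)
      qed
      then have "(\<Sum>m\<in>modes M. a m * B k * (1 / (J (k(j0 := m)) * sqrt (wt m))))
        = B k * (\<Sum>m\<in>modes M. a m / (jap (real_of_int (\<sigma> j0 * int (fst m) + q)) * sqrt (wt m)))"
        by (simp add: sum_distrib_left mult.commute)
      also have "\<dots> \<le> B k * (5 * L2_set a (modes M))"
        using M \<sigma> a by (intro mult_left_mono sum_over_resonance_le B_nonneg) auto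
      finally show ?thesis .
    qed
    then have "(\<Sum>k\<in>tuples M r. a (k j0) * B k * (1 / (J k * sqrt (wt (k j0)))))
        \<le> (\<Sum>k\<in>A \<rightarrow>\<^sub>E modes M. B k * (5 * L2_set a (modes M)))"
      by (simp only: split B_upd fun_upd_same) (rule sum_mono)
    also have "\<dots> = (\<Sum>k\<in>A \<rightarrow>\<^sub>E modes M. B k) * (5 * L2_set a (modes M))"
      by (rule sum_distrib_right [symmetric])
    also have "\<dots> \<le> P * (5 * L2_set a (modes M))"
      by (intro mult_right_mono sum_B) simp
    finally show ?thesis by (simp add: mult_ac)
  qed
  \<comment> \<open>The constraint \<open>k i = k j0\<close> eliminates the mode of slot \<open>j0\<close>, and the sum factorizes over the
    remaining slots. Slot \<open>i\<close> then costs nothing, and \<open>1 \<le> L\<close> lets it be charged like the others.\<close>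
  have repeated: "(\<Sum>k\<in>tuples M r. a (k j0) * B k * of_bool (k i = k j0)) \<le> L2_set a (modes M) * P"
    if "i \<in> A" for i
  proof -
    have "(\<Sum>k\<in>tuples M r. a (k j0) * B k * of_bool (k i = k j0))
        = (\<Sum>k\<in>A \<rightarrow>\<^sub>E modes M. \<Sum>m\<in>modes M. a m * B k * of_bool (k i = m))"
      using that by (simp only: split B_upd fun_upd_same) (auto simp: A_def)
    also have "\<dots> = (\<Sum>k\<in>A \<rightarrow>\<^sub>E modes M. a (k i) * B k)"
    proof (intro sum.cong refl)
      fix k assume "k \<in> A \<rightarrow>\<^sub>E modes M"
      then have "k i \<in> modes M"
        using that by auto
      then show "(\<Sum>m\<in>modes M. a m * B k * of_bool (k i = m)) = a (k i) * B k"
        by (simp add: of_bool_def if_distrib [of "(*) _"] finite_modes cong: if_cong)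
    qed
    also have "\<dots> = (\<Sum>k\<in>A \<rightarrow>\<^sub>E modes M. \<Prod>j\<in>A. (if j = i then a (k j) else 1) * (b j (k j) / wt (k j)))"
      using that \<open>finite A\<close> by (simp only: B_def prod.distrib prod.delta) auto
    also have "\<dots> = (\<Prod>j\<in>A. \<Sum>m\<in>modes M. (if j = i then a m else 1) * (b j m / wt m))"
      using \<open>finite A\<close> by (subst prod_sum_PiE) (auto simp: finite_modes)
    also have "\<dots> \<le> (\<Prod>j\<in>A. (if j = i then L2_set a (modes M) else 1) * (L * L2_set (b j) (modes M)))"
    proof (intro prod_mono conjI sum_nonneg)
      fix j assume "j \<in> A"
      show "(\<Sum>m\<in>modes M. (if j = i then a m else 1) * (b j m / wt m))
          \<le> (if j = i then L2_set a (modes M) else 1) * (L * L2_set (b j) (modes M))"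
      proof (cases "j = i")
        case True
        have "(\<Sum>m\<in>modes M. a m * (b j m / wt m)) \<le> (\<Sum>m\<in>modes M. a m * b j m)"
          using jap_ge_1 jap_pos mult_left_mono [OF jap_ge_1 b]
          by (intro sum_mono mult_left_mono a) (auto simp: divide_le_eq)
        also have "\<dots> \<le> L2_set a (modes M) * (1 * L2_set (b j) (modes M))"
          using a b by (simp add: sum_mult_le_L2_set)
        also have "\<dots> \<le> L2_set a (modes M) * (L * L2_set (b j) (modes M))"
          using L by (intro mult_left_mono mult_right_mono) auto
        finally show ?thesis using True by simp
      next
        case False
        then show ?thesis
          using sum_over_wt_le [OF M, of "b j"] b by (simp add: L_def)
      qed
    qed (auto simp: a b)
    also have "\<dots> = L2_set a (modes M) * P"
      using that \<open>finite A\<close> by (simp only: P_def prod.distrib prod.delta) auto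
    finally show ?thesis .
  qed
  have "(\<Sum>k\<in>tuples M r. a (k j0) * B k * (1 / (J k * sqrt (Upsilon r k))))
      \<le> (\<Sum>k\<in>tuples M r. a (k j0) * B k
          * (1 / (J k * sqrt (wt (k j0))) + (\<Sum>i\<in>A. of_bool (k i = k j0))))"
    unfolding J_def A_def using j0
    by (intro sum_mono mult_left_mono resonance_weight_le mult_nonneg_nonneg a B_nonneg)
  also have "\<dots> = (\<Sum>k\<in>tuples M r. a (k j0) * B k * (1 / (J k * sqrt (wt (k j0)))))
      + (\<Sum>i\<in>A. \<Sum>k\<in>tuples M r. a (k j0) * B k * of_bool (k i = k j0))"
    by (subst sum.swap) (simp only: distrib_left sum.distrib sum_distrib_left)
  also have "\<dots> \<le> 5 * L2_set a (modes M) * P + (\<Sum>i\<in>A. L2_set a (modes M) * P)"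
    by (intro add_mono isolated sum_mono repeated)
  also have "\<dots> \<le> 5 * L2_set a (modes M) * P + real r * (L2_set a (modes M) * P)"
    using P_nonneg j0 by (auto simp: A_def intro!: mult_right_mono)
  also have "\<dots> = (5 + real r) * L2_set a (modes M) * P"
    by (simp add: algebra_simps)
  finally show ?thesis
    unfolding B_def J_def P_def A_def L_def .
qed

section \<open>The multilinear form and its bound\<close>

lemma hnorm_half: "hnorm M (1/2) u = L2_set (\<lambda>k. sqrt (wt k) * cmod (Poly_Mapping.lookup u k)) (modes M)"
  unfolding hnorm_def L2_set_def by (simp add: power_mult_distrib)

lemma hnorm_minus_half:
  "hnorm M (- 1/2) u = L2_set (\<lambda>k. cmod (Poly_Mapping.lookup u k) / sqrt (wt k)) (modes M)"
  unfolding hnorm_def L2_set_def by (simp add: power_divide powr_minus_divide)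

lemma hnorm_nonneg: "0 \<le> hnorm M s u"
  unfolding hnorm_def by (intro real_sqrt_ge_zero sum_nonneg) simp

text \<open>
  A polynomial \<open>\<chi>\<close> with coefficients \<open>c\<close> is the restriction of this real multilinear form to the
  diagonal; its differentials are obtained by changing the arguments in some of the slots.
\<close>

definition mform :: "real \<Rightarrow> nat \<Rightarrow> ((nat \<Rightarrow> int) \<Rightarrow> (nat \<Rightarrow> mode) \<Rightarrow> complex) \<Rightarrow> (nat \<Rightarrow> cseq) \<Rightarrow> complex" where
  "mform M r c w =
     (\<Sum>\<sigma>\<in>sgns r. \<Sum>k\<in>tuples M r. c \<sigma> k * (\<Prod>j<r. conj_pow (Poly_Mapping.lookup (w j) (k j)) (\<sigma> j)))"

lemma cmod_conj_pow [simp]: "cmod (conj_pow z s) = cmod z"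
  by (simp add: conj_pow_def)

text \<open>
  One slot \<open>i\<close> is measured in the norm dual to \<open>h^(1/2)\<close>, all others in \<open>h^(1/2)\<close>. Writing the argument of
  slot \<open>i\<close> as \<open>\<langle>\<ell>\<rangle>^(1/2) a\<close> and the other ones as \<open>\<langle>\<ell>\<rangle>^(-1/2) b j\<close> cancels the weight
  \<open>\<langle>\<ell>\<^sub>i\<rangle>^(1/2)\<close> of the coefficient norm and squares the other ones, which gives the sum of
  \<open>weighted_sum_le\<close> for each sign vector \<open>\<sigma>\<close>. The factor
  \<open>2 ^ r\<close> counts the sign vectors.
\<close>

lemma cmod_mform_le:
  assumes M: "M \<ge> 2" and i: "i < r" and K: "0 \<le> K"
    and c: "\<And>\<sigma> k. \<sigma> \<in> sgns r \<Longrightarrow> k \<in> tuples M r \<Longrightarrow>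
      cmod (c \<sigma> k) * jap (\<Sum>j<r. real_of_int (\<sigma> j) * real (fst (k j)))
        * sqrt (\<Prod>j<r. wt (k j)) * sqrt (Upsilon r k) \<le> K"
  shows "cmod (mform M r c w)
    \<le> 2 ^ r * (K * ((5 + real r) * hnorm M (- 1/2) (w i)
        * (\<Prod>j\<in>{..<r} - {i}. sqrt (12 * ln M) * hnorm M (1/2) (w j))))"
proof -
  define a where "a m = cmod (Poly_Mapping.lookup (w i) m) / sqrt (wt m)" for m
  define b where "b j m = sqrt (wt m) * cmod (Poly_Mapping.lookup (w j) m)" for j m
  define D where "D \<sigma> k = jap (\<Sum>j<r. real_of_int (\<sigma> j) * real (fst (k j))) * sqrt (Upsilon r k)"
    for \<sigma> :: "nat \<Rightarrow> int" and k
  let ?R = "(5 + real r) * hnorm M (- 1/2) (w i)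
        * (\<Prod>j\<in>{..<r} - {i}. sqrt (12 * ln M) * hnorm M (1/2) (w j))"
  have "cmod (\<Sum>k\<in>tuples M r. c \<sigma> k * (\<Prod>j<r. conj_pow (Poly_Mapping.lookup (w j) (k j)) (\<sigma> j)))
      \<le> K * ?R" if \<sigma>: "\<sigma> \<in> sgns r" for \<sigma>
  proof -
    have term_le: "cmod (c \<sigma> k * (\<Prod>j<r. conj_pow (Poly_Mapping.lookup (w j) (k j)) (\<sigma> j)))
        \<le> K * (a (k i) * (\<Prod>j\<in>{..<r} - {i}. b j (k j) / wt (k j)) * (1 / D \<sigma> k))"
      if k: "k \<in> tuples M r" for k
    proof -
      have D: "0 < D \<sigma> k"
        using Upsilon_ge_1 [of r k] unfolding D_def by (intro mult_pos_pos jap_pos) auto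
      have S: "0 < (\<Prod>j<r. sqrt (wt (k j)))"
        by (intro prod_pos) (auto simp: jap_pos)
      have "sqrt (\<Prod>j<r. wt (k j)) = (\<Prod>j<r. sqrt (wt (k j)))"
        by (induction r) (auto simp: real_sqrt_mult)
      then have "cmod (c \<sigma> k) * ((\<Prod>j<r. sqrt (wt (k j))) * D \<sigma> k) \<le> K"
        using c [OF \<sigma> k] by (simp add: D_def mult_ac)
      then have "cmod (c \<sigma> k) \<le> K / ((\<Prod>j<r. sqrt (wt (k j))) * D \<sigma> k)"
        using D S by (simp add: pos_le_divide_eq)
      then have "cmod (c \<sigma> k) * (\<Prod>j<r. cmod (Poly_Mapping.lookup (w j) (k j)))
          \<le> K / ((\<Prod>j<r. sqrt (wt (k j))) * D \<sigma> k) * (\<Prod>j<r. cmod (Poly_Mapping.lookup (w j) (k j)))"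
        by (intro mult_right_mono prod_nonneg) auto
      also have "\<dots> = K * ((\<Prod>j<r. cmod (Poly_Mapping.lookup (w j) (k j)) / sqrt (wt (k j))) * (1 / D \<sigma> k))"
        by (simp add: prod_dividef)
      also have "(\<Prod>j<r. cmod (Poly_Mapping.lookup (w j) (k j)) / sqrt (wt (k j)))
          = a (k i) * (\<Prod>j\<in>{..<r} - {i}. cmod (Poly_Mapping.lookup (w j) (k j)) / sqrt (wt (k j)))"
        using i by (subst prod.remove [of _ i]) (auto simp: a_def)
      also have "(\<Prod>j\<in>{..<r} - {i}. cmod (Poly_Mapping.lookup (w j) (k j)) / sqrt (wt (k j)))
          = (\<Prod>j\<in>{..<r} - {i}. b j (k j) / wt (k j))"
      proof (intro prod.cong refl)
        fix j
        have "sqrt (wt (k j)) * sqrt (wt (k j)) = wt (k j)" by simp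
        then show "cmod (Poly_Mapping.lookup (w j) (k j)) / sqrt (wt (k j)) = b j (k j) / wt (k j)"
          unfolding b_def using jap_pos [of "real (fst (k j))"]
          by (simp add: divide_simps)
      qed
      finally show ?thesis
        by (simp add: norm_mult prod_norm [symmetric])
    qed
    have "cmod (\<Sum>k\<in>tuples M r. c \<sigma> k * (\<Prod>j<r. conj_pow (Poly_Mapping.lookup (w j) (k j)) (\<sigma> j)))
        \<le> (\<Sum>k\<in>tuples M r. K * (a (k i) * (\<Prod>j\<in>{..<r} - {i}. b j (k j) / wt (k j)) * (1 / D \<sigma> k)))"
      by (intro sum_norm_le term_le)
    also have "\<dots> = K * (\<Sum>k\<in>tuples M r. a (k i) * (\<Prod>j\<in>{..<r} - {i}. b j (k j) / wt (k j)) * (1 / D \<sigma> k))"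
      by (rule sum_distrib_left [symmetric])
    also have "\<dots> \<le> K * ((5 + real r) * L2_set a (modes M)
        * (\<Prod>j\<in>{..<r} - {i}. sqrt (12 * ln M) * L2_set (b j) (modes M)))"
      unfolding D_def using \<sigma> i K M
      by (intro mult_left_mono weighted_sum_le) (auto simp: a_def b_def sgns_def)
    also have "\<dots> = K * ?R"
      unfolding hnorm_half hnorm_minus_half a_def b_def ..
    finally show ?thesis .
  qed
  then have "cmod (mform M r c w) \<le> (\<Sum>\<sigma>\<in>sgns r. K * ?R)"
    unfolding mform_def by (rule sum_norm_le)
  also have "\<dots> = 2 ^ r * (K * ?R)"
    by (simp add: sgns_def card_funcsetE)
  finally show ?thesis .
qed

section \<open>Differentiating and polarizing the form\<close>

lemma lookup_scaleR [simp]: "Poly_Mapping.lookup (t *\<^sub>R u) k = t *\<^sub>R Poly_Mapping.lookup u k"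
proof -
  have "finite {k. t *\<^sub>R Poly_Mapping.lookup u k \<noteq> 0}"
    by (rule finite_subset [OF _ finite_keys [of u]]) (auto simp: in_keys_iff)
  then show ?thesis
    by (simp add: scaleR_poly_mapping_def Abs_poly_mapping_inverse)
qed

lemma norm_lookup_le: "norm (Poly_Mapping.lookup u k) \<le> norm u"
proof -
  have "norm u = (\<Sum>k\<in>Poly_Mapping.keys u. norm (Poly_Mapping.lookup u k))"
    by (simp add: norm_poly_mapping_def dist_poly_mapping_def)
  then show ?thesis
    by (cases "k \<in> Poly_Mapping.keys u")
      (auto simp: in_keys_iff sum_nonneg intro!: member_le_sum)
qed

lemma bounded_linear_lookup: "bounded_linear (\<lambda>u. Poly_Mapping.lookup u k)"
  by (rule bounded_linear_intro [where K = 1]) (auto simp: lookup_add norm_lookup_le)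

lemma bounded_linear_conj_pow: "bounded_linear (\<lambda>z. conj_pow z s)"
  unfolding conj_pow_def by (cases "s = 1") (auto simp: bounded_linear_cnj bounded_linear_ident)

lemma bounded_linear_conj_pow_lookup: "bounded_linear (\<lambda>u. conj_pow (Poly_Mapping.lookup u k) s)"
  using bounded_linear_compose [OF bounded_linear_conj_pow bounded_linear_lookup] .

lemma subspace_seqs: "subspace (seqs M)"
proof -
  have "seqs M = {u. \<forall>k. k \<notin> modes M \<longrightarrow> Poly_Mapping.lookup u k = 0}"
    by (auto simp: seqs_def in_keys_iff)
  then show ?thesis
    by (simp add: subspace_def lookup_add)
qed

lemma single_in_seqs: "k \<in> modes M \<Longrightarrow> Poly_Mapping.single k z \<in> seqs M"
  by (auto simp: seqs_def)

lemma mform_fun_upd: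
  assumes "i < r"
  shows "mform M r c (w(i := h)) = (\<Sum>\<sigma>\<in>sgns r. \<Sum>k\<in>tuples M r.
    c \<sigma> k * (conj_pow (Poly_Mapping.lookup h (k i)) (\<sigma> i)
      * (\<Prod>j\<in>{..<r} - {i}. conj_pow (Poly_Mapping.lookup (w j) (k j)) (\<sigma> j))))"
  unfolding mform_def using assms by (simp add: prod.remove [of "{..<r}" i])

lemma linear_mform_slot:
  assumes "i < r"
  shows "linear (\<lambda>h. mform M r c (w(i := h)))"
proof (rule linearI)
  have lin: "linear (\<lambda>u. conj_pow (Poly_Mapping.lookup u k) s)" for k s
    using bounded_linear_conj_pow_lookup by (rule bounded_linear.linear)
  show "mform M r c (w(i := h + h')) = mform M r c (w(i := h)) + mform M r c (w(i := h'))" for h h'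
    unfolding mform_fun_upd [OF assms] linear_add [OF lin]
    by (simp add: algebra_simps sum.distrib)
  show "mform M r c (w(i := t *\<^sub>R h)) = t *\<^sub>R mform M r c (w(i := h))" for t h
    unfolding mform_fun_upd [OF assms] linear_scale [OF lin]
    by (simp add: scaleR_sum_right)
qed

text \<open>
  The arguments are allowed to depend on the point in an arbitrary way because the rule is needed
  along a line (to polarize), on the diagonal (for the gradient), and with one slot frozen (for the
  differential of the gradient).
\<close>

lemma mform_has_derivative:
  assumes "\<And>j. j < r \<Longrightarrow> ((\<lambda>x. w x j) has_derivative w' j) (at x within S)"
  shows "((\<lambda>x. mform M r c (w x)) has_derivative (\<lambda>v. \<Sum>i<r. mform M r c ((w x)(i := w' i v)))) (at x within S)"
proof -
  have coord: "((\<lambda>x. conj_pow (Poly_Mapping.lookup (w x j) (k j)) (\<sigma> j)) has_derivative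
      (\<lambda>v. conj_pow (Poly_Mapping.lookup (w' j v) (k j)) (\<sigma> j))) (at x within S)"
    if "j < r" for j k \<sigma>
    using bounded_linear.has_derivative [OF bounded_linear_conj_pow_lookup assms [OF that]] .
  have "((\<lambda>x. mform M r c (w x)) has_derivative (\<lambda>v. \<Sum>\<sigma>\<in>sgns r. \<Sum>k\<in>tuples M r. c \<sigma> k *
      (\<Sum>i<r. conj_pow (Poly_Mapping.lookup (w' i v) (k i)) (\<sigma> i)
        * (\<Prod>j\<in>{..<r} - {i}. conj_pow (Poly_Mapping.lookup (w x j) (k j)) (\<sigma> j))))) (at x within S)"
    unfolding mform_def
    by (intro has_derivative_sum has_derivative_mult_right has_derivative_prod coord) auto
  also have "(\<lambda>v. \<Sum>\<sigma>\<in>sgns r. \<Sum>k\<in>tuples M r. c \<sigma> k *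
      (\<Sum>i<r. conj_pow (Poly_Mapping.lookup (w' i v) (k i)) (\<sigma> i)
        * (\<Prod>j\<in>{..<r} - {i}. conj_pow (Poly_Mapping.lookup (w x j) (k j)) (\<sigma> j))))
      = (\<lambda>v. \<Sum>i<r. mform M r c ((w x)(i := w' i v)))"
  proof
    fix v
    have "(\<Sum>\<sigma>\<in>sgns r. \<Sum>k\<in>tuples M r. c \<sigma> k *
      (\<Sum>i<r. conj_pow (Poly_Mapping.lookup (w' i v) (k i)) (\<sigma> i)
        * (\<Prod>j\<in>{..<r} - {i}. conj_pow (Poly_Mapping.lookup (w x j) (k j)) (\<sigma> j))))
      = (\<Sum>\<sigma>\<in>sgns r. \<Sum>i<r. \<Sum>k\<in>tuples M r. c \<sigma> k *
      (conj_pow (Poly_Mapping.lookup (w' i v) (k i)) (\<sigma> i)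
        * (\<Prod>j\<in>{..<r} - {i}. conj_pow (Poly_Mapping.lookup (w x j) (k j)) (\<sigma> j))))"
      by (subst (2) sum.swap) (simp only: sum_distrib_left)
    also have "\<dots> = (\<Sum>i<r. mform M r c ((w x)(i := w' i v)))"
      by (subst sum.swap) (simp add: mform_fun_upd)
    finally show "(\<Sum>\<sigma>\<in>sgns r. \<Sum>k\<in>tuples M r. c \<sigma> k *
      (\<Sum>i<r. conj_pow (Poly_Mapping.lookup (w' i v) (k i)) (\<sigma> i)
        * (\<Prod>j\<in>{..<r} - {i}. conj_pow (Poly_Mapping.lookup (w x j) (k j)) (\<sigma> j))))
      = (\<Sum>i<r. mform M r c ((w x)(i := w' i v)))" .
  qed
  finally show ?thesis .
qed

lemma bij_betw_PiE_permute:
  assumes "\<pi> permutes A"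
  shows "bij_betw (\<lambda>f. f \<circ> \<pi>) (A \<rightarrow>\<^sub>E B) (A \<rightarrow>\<^sub>E B)"
proof -
  have "f \<circ> \<rho> \<in> A \<rightarrow>\<^sub>E B" if "\<rho> permutes A" "f \<in> A \<rightarrow>\<^sub>E B" for f :: "'a \<Rightarrow> 'b" and \<rho>
    using that by (auto simp: PiE_def extensional_def permutes_in_image permutes_not_in)
  then show ?thesis
    using assms
    by (intro bij_betw_byWitness [where f' = "\<lambda>f. f \<circ> inv \<pi>"] ballI image_subsetI)
      (simp_all add: permutes_inv comp_assoc permutes_inv_o)
qed

definition permutation_invariant :: "real \<Rightarrow> nat \<Rightarrow> ((nat \<Rightarrow> int) \<Rightarrow> (nat \<Rightarrow> mode) \<Rightarrow> complex) \<Rightarrow> bool" where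
  "permutation_invariant M r c \<longleftrightarrow>
     (\<forall>\<sigma>\<in>sgns r. \<forall>k\<in>tuples M r. \<forall>\<pi>. \<pi> permutes {..<r} \<longrightarrow> c (\<sigma> \<circ> \<pi>) (k \<circ> \<pi>) = c \<sigma> k)"

lemma mform_permute_coeffs:
  assumes \<pi>: "\<pi> permutes {..<r}"
  shows "mform M r (\<lambda>\<sigma> k. c (\<sigma> \<circ> \<pi>) (k \<circ> \<pi>)) w = mform M r c (w \<circ> \<pi>)"
proof -
  have "mform M r c (w \<circ> \<pi>) = (\<Sum>\<sigma>\<in>sgns r. \<Sum>k\<in>tuples M r. c (\<sigma> \<circ> \<pi>) (k \<circ> \<pi>)
      * (\<Prod>j<r. conj_pow (Poly_Mapping.lookup ((w \<circ> \<pi>) j) ((k \<circ> \<pi>) j)) ((\<sigma> \<circ> \<pi>) j)))"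
    unfolding mform_def sgns_def tuples_def
    by (subst sum.reindex_bij_betw [OF bij_betw_PiE_permute [OF \<pi>], symmetric],
        rule sum.cong [OF refl],
        rule sum.reindex_bij_betw [OF bij_betw_PiE_permute [OF \<pi>], symmetric])
  also have "\<dots> = mform M r (\<lambda>\<sigma> k. c (\<sigma> \<circ> \<pi>) (k \<circ> \<pi>)) w"
  proof -
    have "(\<Prod>j<r. conj_pow (Poly_Mapping.lookup ((w \<circ> \<pi>) j) ((k \<circ> \<pi>) j)) ((\<sigma> \<circ> \<pi>) j))
        = (\<Prod>j<r. conj_pow (Poly_Mapping.lookup (w j) (k j)) (\<sigma> j))" for \<sigma> k
      using prod.permute [OF \<pi>, of "\<lambda>j. conj_pow (Poly_Mapping.lookup (w j) (k j)) (\<sigma> j)"]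
      by (simp add: o_def)
    then show ?thesis
      unfolding mform_def by simp
  qed
  finally show ?thesis ..
qed

lemma mform_permute:
  assumes "permutation_invariant M r c" "\<pi> permutes {..<r}"
  shows "mform M r c (w \<circ> \<pi>) = mform M r c w"
  using assms(1) unfolding mform_permute_coeffs [OF assms(2), symmetric]
  by (simp add: mform_def permutation_invariant_def assms(2))

text \<open>
  The arguments \<open>w j\<close> are substituted one slot at a time: differentiating the vanishing form at
  \<open>u + t w s\<close> produces one term for each slot that still contains \<open>u\<close>, and by symmetry these terms
  coincide.
\<close>

lemma mform_polarize:
  assumes sym: "permutation_invariant M r c"
    and zero: "\<And>u. u \<in> seqs M \<Longrightarrow> mform M r c (\<lambda>_. u) = 0"
    and w: "\<And>j. w j \<in> seqs M"
  shows "mform M r c w = 0"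
proof -
  have "mform M r c (\<lambda>j. if j < s then w j else u) = 0" if "s \<le> r" "u \<in> seqs M" for s u
    using that
  proof (induction s arbitrary: u)
    case 0
    then show ?case using zero by simp
  next
    case (Suc s)
    define base where "base j = (if j < s then w j else u)" for j
    define W where "W t j = (if j < s then w j else u + t *\<^sub>R w s)" for t :: real and j
    define W' where "W' j t = (if j < s then 0 else t *\<^sub>R w s)" for j and t :: real
    have "((\<lambda>t. mform M r c (W t)) has_derivative (\<lambda>t. \<Sum>i<r. mform M r c ((W 0)(i := W' i t)))) (at 0)"
    proof (rule mform_has_derivative)
      show "((\<lambda>t. W t j) has_derivative W' j) (at 0)" for j
        unfolding W_def W'_def by (cases "j < s") (auto intro!: derivative_eq_intros)
    qed
    moreover have "mform M r c (W t) = 0" for t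
      unfolding W_def using Suc w
      by (intro Suc.IH) (auto intro: subspace_add subspace_scale subspace_seqs)
    then have "((\<lambda>t. mform M r c (W t)) has_derivative (\<lambda>t. 0)) (at 0)"
      by simp
    ultimately have "(\<lambda>t. \<Sum>i<r. mform M r c ((W 0)(i := W' i t))) = (\<lambda>t. 0)"
      by (rule has_derivative_unique)
    moreover have "W 0 = base"
      by (auto simp: W_def base_def)
    ultimately have "(\<Sum>i<r. mform M r c (base(i := W' i 1))) = 0"
      by metis
    moreover have "mform M r c (base(i := W' i 1)) = (if i < s then 0 else mform M r c (base(s := w s)))"
      if "i < r" for i
    proof (cases "i < s")
      case True
      then show ?thesis
        using linear_0 [OF linear_mform_slot [OF that]] by (simp add: W'_def)
    next
      case False
      \<comment> \<open>Slots \<open>i\<close> and \<open>s\<close> both hold \<open>u\<close>, so exchanging them moves the direction \<open>w s\<close> from \<open>i\<close> to \<open>s\<close>.\<close>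
      have "Transposition.transpose i s permutes {..<r}"
        using that Suc.prems by (intro permutes_swap_id) auto
      from mform_permute [OF sym this, of "base(i := w s)"]
      have "mform M r c (base(i := w s)) = mform M r c (base(i := w s) \<circ> Transposition.transpose i s)" ..
      also have "base(i := w s) \<circ> Transposition.transpose i s = base(s := w s)"
        using False by (auto simp: fun_eq_iff base_def Transposition.transpose_def)
      finally show ?thesis
        using False by (simp add: W'_def fun_upd_def)
    qed
    ultimately have "(\<Sum>i<r. if i < s then 0 else mform M r c (base(s := w s))) = 0"
      by simp
    moreover have "(\<Sum>i<r. if i < s then 0 else mform M r c (base(s := w s)))
        = of_nat (r - s) * mform M r c (base(s := w s))"
    proof -
      have "{..<r} \<inter> {i. \<not> i < s} = {s..<r}" by auto
      then show ?thesis
        by (simp add: sum.If_cases Collect_neg_eq [symmetric])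
    qed
    ultimately have "mform M r c (base(s := w s)) = 0"
      using Suc.prems by simp
    also have "base(s := w s) = (\<lambda>j. if j < Suc s then w j else u)"
      by (auto simp: base_def)
    finally show ?case .
  qed
  from this [of r "w 0"] have "mform M r c (\<lambda>j. if j < r then w j else w 0) = 0"
    using w by simp
  then show ?thesis
    by (simp add: mform_def)
qed

text \<open>
  A coefficient is recovered by testing slot \<open>j\<close> with the unit vectors of mode \<open>k0 j\<close> multiplied by
  \<open>1\<close> and \<open>\<i>\<close>. The form is only real linear in each slot, and the combination with weights \<open>\<gamma>\<close>
  separates the linear from the antilinear part, as \<open>conj_pow z s\<close> is linear in \<open>z\<close> or in its conjugate.
\<close>

lemma coeffs_eq_zero:
  assumes zero: "\<And>w. (\<And>j. w j \<in> seqs M) \<Longrightarrow> mform M r c w = 0"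
    and \<sigma>0: "\<sigma>0 \<in> sgns r" and k0: "k0 \<in> tuples M r"
  shows "c \<sigma>0 k0 = 0"
proof -
  define \<gamma> where "\<gamma> s z = (if z = 1 then 1/2 else - \<i> * of_int s / 2)" for s :: int and z :: complex
  have delta: "(\<Sum>z\<in>{1, \<i>}. \<gamma> s z * conj_pow (Poly_Mapping.lookup (Poly_Mapping.single m z) m') s')
      = of_bool (s' = s \<and> m' = m)" if "s \<in> {- 1, 1}" "s' \<in> {- 1, 1}" for s s' and m m' :: mode
    using that by (auto simp: \<gamma>_def conj_pow_def lookup_single when_def)
  have prod_delta: "(\<Prod>j<r. \<Sum>z\<in>{1, \<i>}. \<gamma> (\<sigma>0 j) z * conj_pow (Poly_Mapping.lookup (Poly_Mapping.single (k0 j) z) (k j)) (\<sigma> j))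
      = of_bool (\<sigma> = \<sigma>0 \<and> k = k0)" if "\<sigma> \<in> sgns r" "k \<in> tuples M r" for \<sigma> k
  proof -
    have "(\<Prod>j<r. \<Sum>z\<in>{1, \<i>}. \<gamma> (\<sigma>0 j) z * conj_pow (Poly_Mapping.lookup (Poly_Mapping.single (k0 j) z) (k j)) (\<sigma> j))
        = (\<Prod>j<r. of_bool (\<sigma> j = \<sigma>0 j \<and> k j = k0 j))"
      using that \<sigma>0 by (intro prod.cong delta) (auto simp: sgns_def)
    also have "\<dots> = of_bool (\<forall>j<r. \<sigma> j = \<sigma>0 j \<and> k j = k0 j)"
      by (cases "\<forall>j<r. \<sigma> j = \<sigma>0 j \<and> k j = k0 j") (auto intro: prod_zero)
    also have "(\<forall>j<r. \<sigma> j = \<sigma>0 j \<and> k j = k0 j) \<longleftrightarrow> \<sigma> = \<sigma>0 \<and> k = k0"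
    proof (intro iffI conjI)
      assume *: "\<forall>j<r. \<sigma> j = \<sigma>0 j \<and> k j = k0 j"
      show "\<sigma> = \<sigma>0"
        using that(1) \<sigma>0 * unfolding sgns_def by (intro PiE_ext) auto
      show "k = k0"
        using that(2) k0 * unfolding tuples_def by (intro PiE_ext) auto
    qed auto
    finally show ?thesis .
  qed
  have "c \<sigma>0 k0 = (\<Sum>\<sigma>\<in>sgns r. \<Sum>k\<in>tuples M r. c \<sigma> k * of_bool (\<sigma> = \<sigma>0 \<and> k = k0))"
  proof -
    have "(\<Sum>\<sigma>\<in>sgns r. \<Sum>k\<in>tuples M r. c \<sigma> k * of_bool (\<sigma> = \<sigma>0 \<and> k = k0))
        = (\<Sum>\<sigma>\<in>sgns r. if \<sigma> = \<sigma>0 then \<Sum>k\<in>tuples M r. if k = k0 then c \<sigma> k else 0 else 0)"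
      by (intro sum.cong refl) (auto intro!: sum.cong)
    then show ?thesis
      using \<sigma>0 k0 by (simp add: finite_sgns finite_tuples)
  qed
  also have "\<dots> = (\<Sum>\<sigma>\<in>sgns r. \<Sum>k\<in>tuples M r. \<Sum>Z\<in>{..<r} \<rightarrow>\<^sub>E {1, \<i>}.
      (\<Prod>j<r. \<gamma> (\<sigma>0 j) (Z j)) * (c \<sigma> k * (\<Prod>j<r. conj_pow (Poly_Mapping.lookup (Poly_Mapping.single (k0 j) (Z j)) (k j)) (\<sigma> j))))"
    by (intro sum.cong refl, subst prod_delta [symmetric], assumption, assumption, subst prod_sum_PiE)
      (simp_all add: prod.distrib sum_distrib_left mult_ac)
  also have "\<dots> = (\<Sum>Z\<in>{..<r} \<rightarrow>\<^sub>E {1, \<i>}. (\<Prod>j<r. \<gamma> (\<sigma>0 j) (Z j))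
      * mform M r c (\<lambda>j. Poly_Mapping.single (k0 j) (Z j)))"
    unfolding mform_def sum_distrib_left
    by (subst sum.swap, subst sum.swap) (rule refl)
  also have "\<dots> = 0"
  proof (rule sum.neutral, rule ballI)
    fix Z
    have "mform M r c (\<lambda>j. Poly_Mapping.single (k0 j) (Z j))
        = mform M r c (\<lambda>j. if j < r then Poly_Mapping.single (k0 j) (Z j) else 0)"
      by (simp add: mform_def)
    also have "\<dots> = 0"
      using k0 by (intro zero) (auto simp: tuples_def intro!: single_in_seqs subspace_0 subspace_seqs)
    finally show "(\<Prod>j<r. \<gamma> (\<sigma>0 j) (Z j)) * mform M r c (\<lambda>j. Poly_Mapping.single (k0 j) (Z j)) = 0"
      by simp
  qed
  finally show ?thesis .
qed

section \<open>Existence and uniqueness of the coefficients\<close>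

lemma lookup_sum: "Poly_Mapping.lookup (sum f A) k = (\<Sum>m\<in>A. Poly_Mapping.lookup (f m) k)"
  by (induction A rule: infinite_finite_induct) (auto simp: lookup_add)

lemma linear_on_seqs:
  assumes h: "linear (h :: cseq \<Rightarrow> real)" and u: "u \<in> seqs M"
  shows "h u = (\<Sum>m\<in>modes M. Re (Poly_Mapping.lookup u m) * h (Poly_Mapping.single m 1)
      + Im (Poly_Mapping.lookup u m) * h (Poly_Mapping.single m \<i>))"
proof -
  have "u = (\<Sum>m\<in>modes M. Re (Poly_Mapping.lookup u m) *\<^sub>R Poly_Mapping.single m 1
      + Im (Poly_Mapping.lookup u m) *\<^sub>R Poly_Mapping.single m \<i>)"
  proof (rule poly_mapping_eqI)
    fix k
    have "(\<Sum>m\<in>modes M. Re (Poly_Mapping.lookup u m) *\<^sub>R (1 when m = k)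
        + Im (Poly_Mapping.lookup u m) *\<^sub>R (\<i> when m = k))
      = (\<Sum>m\<in>modes M. if k = m then Poly_Mapping.lookup u m else 0)"
      by (intro sum.cong refl) (auto simp: complex_eq_iff)
    also have "\<dots> = Poly_Mapping.lookup u k"
      using u by (auto simp: finite_modes seqs_def in_keys_iff)
    finally show "Poly_Mapping.lookup u k
      = Poly_Mapping.lookup (\<Sum>m\<in>modes M. Re (Poly_Mapping.lookup u m) *\<^sub>R Poly_Mapping.single m 1
      + Im (Poly_Mapping.lookup u m) *\<^sub>R Poly_Mapping.single m \<i>) k"
      by (simp add: lookup_sum lookup_add lookup_single)
  qed
  then have "h u = h (\<Sum>m\<in>modes M. Re (Poly_Mapping.lookup u m) *\<^sub>R Poly_Mapping.single m 1
      + Im (Poly_Mapping.lookup u m) *\<^sub>R Poly_Mapping.single m \<i>)"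
    by simp
  then show ?thesis
    by (simp add: linear_sum [OF h] linear_add [OF h] linear_scale [OF h])
qed

text \<open>
  The coefficients are left without any symmetry here; this makes the class closed under products
  without reindexing, and symmetry is restored at the very end.
\<close>

definition is_form :: "real \<Rightarrow> nat \<Rightarrow> (cseq \<Rightarrow> complex) \<Rightarrow> bool" where
  "is_form M d f \<longleftrightarrow> (\<exists>c. \<forall>u\<in>seqs M. f u = mform M d c (\<lambda>_. u))"

lemma is_form_zero: "is_form M d (\<lambda>_. 0)"
  unfolding is_form_def by (rule exI [of _ "\<lambda>_ _. 0"]) (simp add: mform_def)

lemma mform_0: "mform M 0 c w = c (\<lambda>_. undefined) (\<lambda>_. undefined)"
  by (simp add: mform_def sgns_def tuples_def)

lemma is_form_const: "is_form M 0 (\<lambda>_. z)"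
  unfolding is_form_def by (rule exI [of _ "\<lambda>_ _. z"]) (simp add: mform_0)

lemma is_form_add: "is_form M d f \<Longrightarrow> is_form M d g \<Longrightarrow> is_form M d (\<lambda>u. f u + g u)"
  unfolding is_form_def
proof (elim exE)
  fix c c' assume "\<forall>u\<in>seqs M. f u = mform M d c (\<lambda>_. u)" "\<forall>u\<in>seqs M. g u = mform M d c' (\<lambda>_. u)"
  then show "\<exists>c. \<forall>u\<in>seqs M. f u + g u = mform M d c (\<lambda>_. u)"
    by (intro exI [of _ "\<lambda>\<sigma> k. c \<sigma> k + c' \<sigma> k"]) (simp add: mform_def algebra_simps sum.distrib)
qed

lemma is_form_sum: "(\<And>i. i \<in> A \<Longrightarrow> is_form M d (f i)) \<Longrightarrow> is_form M d (\<lambda>u. \<Sum>i\<in>A. f i u)"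
  by (induction A rule: infinite_finite_induct) (auto simp: is_form_zero is_form_add)

lemma is_form_cmult: "is_form M d f \<Longrightarrow> is_form M d (\<lambda>u. z * f u)"
  unfolding is_form_def
proof (elim exE)
  fix c assume "\<forall>u\<in>seqs M. f u = mform M d c (\<lambda>_. u)"
  then show "\<exists>c. \<forall>u\<in>seqs M. z * f u = mform M d c (\<lambda>_. u)"
    by (intro exI [of _ "\<lambda>\<sigma> k. z * c \<sigma> k"]) (simp add: mform_def sum_distrib_left mult.assoc)
qed

lemma is_form_cong: "(\<And>u. u \<in> seqs M \<Longrightarrow> f u = g u) \<Longrightarrow> is_form M d f \<longleftrightarrow> is_form M d g"
  by (simp add: is_form_def)

lemma mform_Suc:
  "mform M (Suc d) c w = (\<Sum>s\<in>{- 1, 1}. \<Sum>m\<in>modes M. conj_pow (Poly_Mapping.lookup (w d) m) s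
      * mform M d (\<lambda>\<sigma> k. c (\<sigma>(d := s)) (k(d := m))) w)"
proof -
  define F where "F \<sigma> k = (\<Prod>j<d. conj_pow (Poly_Mapping.lookup (w j) (k j)) (\<sigma> j))" for \<sigma> k
  have F_upd: "F (\<sigma>(d := s)) (k(d := m)) = F \<sigma> k" for \<sigma> k s m
    unfolding F_def by (intro prod.cong) auto
  have less: "{..<Suc d} - {d} = {..<d}" by auto
  have "mform M (Suc d) c w = (\<Sum>\<sigma>\<in>sgns d. \<Sum>s\<in>{- 1, 1}. \<Sum>k\<in>tuples M d. \<Sum>m\<in>modes M.
      c (\<sigma>(d := s)) (k(d := m)) * (F \<sigma> k * conj_pow (Poly_Mapping.lookup (w d) m) s))"
    unfolding mform_def prod.lessThan_Suc F_def [symmetric] sgns_def tuples_def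
    by (simp only: sum_PiE_split_slot [of d "{..<Suc d}"] lessThan_iff lessI less F_upd fun_upd_same)
  also have "\<dots> = (\<Sum>s\<in>{- 1, 1}. \<Sum>\<sigma>\<in>sgns d. \<Sum>m\<in>modes M. \<Sum>k\<in>tuples M d.
      c (\<sigma>(d := s)) (k(d := m)) * (F \<sigma> k * conj_pow (Poly_Mapping.lookup (w d) m) s))"
    by (subst sum.swap, intro sum.cong refl, subst sum.swap, rule refl)
  also have "\<dots> = (\<Sum>s\<in>{- 1, 1}. \<Sum>m\<in>modes M. \<Sum>\<sigma>\<in>sgns d. \<Sum>k\<in>tuples M d.
      c (\<sigma>(d := s)) (k(d := m)) * (F \<sigma> k * conj_pow (Poly_Mapping.lookup (w d) m) s))"
    by (intro sum.cong refl sum.swap)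
  finally show ?thesis
    by (simp only: mform_def F_def sum_distrib_left mult_ac)
qed

text \<open>
  Splitting off the last slot turns statements on forms into inductions on the degree in which the
  coefficients no longer appear.
\<close>

lemma is_form_Suc_iff:
  "is_form M (Suc d) f \<longleftrightarrow> (\<exists>g. (\<forall>s m. is_form M d (g s m)) \<and>
     (\<forall>u\<in>seqs M. f u = (\<Sum>s\<in>{- 1, 1}. \<Sum>m\<in>modes M. conj_pow (Poly_Mapping.lookup u m) s * g s m u)))"
  (is "_ \<longleftrightarrow> ?rhs")
proof
  assume "is_form M (Suc d) f"
  then obtain c where "\<forall>u\<in>seqs M. f u = mform M (Suc d) c (\<lambda>_. u)"
    unfolding is_form_def by blast
  then show ?rhs
    by (intro exI [of _ "\<lambda>s m u. mform M d (\<lambda>\<sigma> k. c (\<sigma>(d := s)) (k(d := m))) (\<lambda>_. u)"])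
      (auto simp only: mform_Suc is_form_def)
next
  assume ?rhs
  then obtain g where f: "\<And>u. u \<in> seqs M \<Longrightarrow>
      f u = (\<Sum>s\<in>{- 1, 1}. \<Sum>m\<in>modes M. conj_pow (Poly_Mapping.lookup u m) s * g s m u)"
    and "\<forall>s m. \<exists>c. \<forall>u\<in>seqs M. g s m u = mform M d c (\<lambda>_. u)"
    unfolding is_form_def by blast
  then obtain c where g: "\<And>s m u. u \<in> seqs M \<Longrightarrow> g s m u = mform M d (c s m) (\<lambda>_. u)"
    by metis
  \<comment> \<open>Restriction to \<open>{..<d}\<close> means resetting the value at \<open>d\<close> to \<open>undefined\<close>, the value that extensional
    functions on \<open>{..<d}\<close> take there.\<close>
  let ?C = "\<lambda>\<sigma> k. c (\<sigma> d) (k d) (\<sigma>(d := undefined)) (k(d := undefined))"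
  have "mform M d (\<lambda>\<sigma> k. ?C (\<sigma>(d := s)) (k(d := m))) w = mform M d (c s m) w" for s m w
  proof -
    have "\<sigma>(d := undefined) = \<sigma>" if "\<sigma> \<in> {..<d} \<rightarrow>\<^sub>E {- 1, 1}" for \<sigma> :: "nat \<Rightarrow> int"
      using that by (auto simp: fun_eq_iff PiE_def extensional_def)
    moreover have "k(d := undefined) = k" if "k \<in> {..<d} \<rightarrow>\<^sub>E modes M" for k
      using that by (auto simp: fun_eq_iff PiE_def extensional_def)
    ultimately show ?thesis
      unfolding mform_def sgns_def tuples_def by (intro sum.cong refl) simp
  qed
  then have "f u = mform M (Suc d) ?C (\<lambda>_. u)" if "u \<in> seqs M" for u
    unfolding mform_Suc f [OF that] g [OF that] by simp
  then show "is_form M (Suc d) f"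
    unfolding is_form_def by (intro exI [of _ ?C]) blast
qed

lemma is_form_mult:
  assumes g: "is_form M e g"
  shows "is_form M d f \<Longrightarrow> is_form M (d + e) (\<lambda>u. f u * g u)"
proof (induction d arbitrary: f)
  case 0
  then obtain c where "\<forall>u\<in>seqs M. f u = mform M 0 c (\<lambda>_. u)"
    unfolding is_form_def by blast
  then have "f u * g u = c (\<lambda>_. undefined) (\<lambda>_. undefined) * g u" if "u \<in> seqs M" for u
    using that by (simp add: mform_0)
  then show ?case
    using is_form_cmult [OF g, of "c (\<lambda>_. undefined) (\<lambda>_. undefined)"]
    unfolding add_0 by (subst is_form_cong) auto
next
  case (Suc d)
  then obtain F where F: "\<And>s m. is_form M d (F s m)" "\<And>u. u \<in> seqs M \<Longrightarrow>
      f u = (\<Sum>s\<in>{- 1, 1}. \<Sum>m\<in>modes M. conj_pow (Poly_Mapping.lookup u m) s * F s m u)"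
    unfolding is_form_Suc_iff by blast
  have "f u * g u = (\<Sum>s\<in>{- 1, 1}. \<Sum>m\<in>modes M. conj_pow (Poly_Mapping.lookup u m) s * (F s m u * g u))"
    if "u \<in> seqs M" for u
    unfolding F(2) [OF that] sum_distrib_right mult.assoc ..
  then show ?case
    unfolding add_Suc is_form_Suc_iff using Suc.IH [OF F(1)]
    by (intro exI [of _ "\<lambda>s m u. F s m u * g u"]) auto
qed

lemma is_form_linear:
  assumes "linear (h :: cseq \<Rightarrow> real)"
  shows "is_form M 1 (\<lambda>u. complex_of_real (h u))"
proof -
  define z where "z s m = (complex_of_real (h (Poly_Mapping.single m 1))
      - \<i> * of_int s * of_real (h (Poly_Mapping.single m \<i>))) / 2" for s m
  have "complex_of_real (h u)
      = (\<Sum>s\<in>{- 1, 1}. \<Sum>m\<in>modes M. conj_pow (Poly_Mapping.lookup u m) s * z s m)" if "u \<in> seqs M" for u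
  proof -
    have "complex_of_real (Re y * a + Im y * b)
        = (\<Sum>s\<in>{- 1, 1}. conj_pow y s * ((of_real a - \<i> * of_int s * of_real b) / 2))" for y a b
      by (simp add: conj_pow_def complex_eq_iff field_simps)
    then show ?thesis
      unfolding linear_on_seqs [OF assms that] of_real_sum z_def
      by (subst sum.swap) (simp only:)
  qed
  then show ?thesis
    unfolding One_nat_def is_form_Suc_iff by (intro exI [of _ "\<lambda>s m u. z s m"]) (auto simp: is_form_const)
qed

text \<open>
  The homogeneous components of a polynomial function are collected as the coefficients of the
  univariate polynomial \<open>t \<mapsto> p (t u)\<close>, so that the product rule for components is the convolution formula
  for polynomial coefficients.
\<close>

lemma real_polynomial_function_graded:
  assumes "real_polynomial_function p"
  shows "\<exists>P :: cseq \<Rightarrow> complex poly. (\<forall>d. is_form M d (\<lambda>u. coeff (P u) d)) \<and>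
    (\<forall>u\<in>seqs M. \<forall>t. complex_of_real (p (t *\<^sub>R u)) = poly (P u) (of_real t))"
  using assms
proof (induction p rule: real_polynomial_function.induct)
  case (linear h)
  then have h: "linear h"
    by (rule bounded_linear.linear)
  have "is_form M d (\<lambda>u. coeff [:0, complex_of_real (h u):] d)" for d
  proof (cases "d = 1")
    case True
    then show ?thesis using is_form_linear [OF h, of M] by simp
  next
    case False
    then have "coeff [:0, complex_of_real (h u):] d = 0" for u
      by (simp add: coeff_pCons split: nat.split)
    then show ?thesis by (simp add: is_form_zero)
  qed
  then show ?case
    by (intro exI [of _ "\<lambda>u. [:0, complex_of_real (h u):]"]) (simp add: linear_scale [OF h])
next
  case (const z)
  have "is_form M d (\<lambda>u. coeff [:complex_of_real z:] d)" for d
    by (cases d) (auto simp: is_form_zero is_form_const)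
  then show ?case
    by (intro exI [of _ "\<lambda>u. [:complex_of_real z:]"]) simp
next
  case (add f g)
  then obtain P Q where
    "\<forall>d. is_form M d (\<lambda>u. coeff (P u) d)" "\<forall>u\<in>seqs M. \<forall>t. complex_of_real (f (t *\<^sub>R u)) = poly (P u) (of_real t)"
    "\<forall>d. is_form M d (\<lambda>u. coeff (Q u) d)" "\<forall>u\<in>seqs M. \<forall>t. complex_of_real (g (t *\<^sub>R u)) = poly (Q u) (of_real t)"
    by blast
  then show ?case
    by (intro exI [of _ "\<lambda>u. P u + Q u"]) (auto intro: is_form_add)
next
  case (mult f g)
  then obtain P Q where
    PQ: "\<And>d. is_form M d (\<lambda>u. coeff (P u) d)" "\<And>d. is_form M d (\<lambda>u. coeff (Q u) d)"
      "\<forall>u\<in>seqs M. \<forall>t. complex_of_real (f (t *\<^sub>R u)) = poly (P u) (of_real t)"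
      "\<forall>u\<in>seqs M. \<forall>t. complex_of_real (g (t *\<^sub>R u)) = poly (Q u) (of_real t)"
    by blast
  have "is_form M d (\<lambda>u. coeff (P u * Q u) d)" for d
    unfolding coeff_mult
  proof (rule is_form_sum)
    fix i assume "i \<in> {..d}"
    then show "is_form M d (\<lambda>u. coeff (P u) i * coeff (Q u) (d - i))"
      using is_form_mult [OF PQ(2) [of "d - i"] PQ(1) [of i]] by simp
  qed
  then show ?case
    using PQ(3,4) by (intro exI [of _ "\<lambda>u. P u * Q u"]) auto
qed

text \<open>
  Homogeneity says that \<open>t \<mapsto> p (t u)\<close> agrees with \<open>t\<^sup>r \<chi>(u)\<close> at infinitely many \<open>t\<close>, whence only the component
  of degree \<open>r\<close> survives.
\<close>

lemma homog_polys_is_form: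
  assumes "chi \<in> homog_polys M r"
  shows "is_form M r (\<lambda>u. complex_of_real (chi u))"
proof -
  obtain p where p: "real_polynomial_function p" "\<And>u. u \<in> seqs M \<Longrightarrow> chi u = p u"
    and hom: "\<And>t u. u \<in> seqs M \<Longrightarrow> chi (t *\<^sub>R u) = t ^ r * chi u"
    using assms by (auto simp: homog_polys_def)
  obtain P where P: "\<And>d. is_form M d (\<lambda>u. coeff (P u) d)"
      "\<And>u t. u \<in> seqs M \<Longrightarrow> complex_of_real (p (t *\<^sub>R u)) = poly (P u) (of_real t)"
    using real_polynomial_function_graded [OF p(1)] by metis
  have "coeff (P u) r = complex_of_real (chi u)" if u: "u \<in> seqs M" for u
  proof -
    have "poly (P u - monom (of_real (chi u)) r) (of_real t) = 0" for t
      using P(2) [OF u, of t] p(2) [of "t *\<^sub>R u"] hom [OF u, of t] subspace_scale [OF subspace_seqs u]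
      by (simp add: poly_monom mult.commute flip: of_real_power of_real_mult)
    then have "range complex_of_real \<subseteq> {z. poly (P u - monom (of_real (chi u)) r) z = 0}"
      by auto
    moreover have "infinite (range complex_of_real)"
      by (simp add: finite_image_iff inj_of_real infinite_UNIV_char_0)
    ultimately have "P u - monom (of_real (chi u)) r = 0"
      using poly_roots_finite finite_subset by metis
    then show ?thesis by simp
  qed
  then show ?thesis
    using P(1) [of r] by (simp cong: is_form_cong)
qed

lemma is_coeffs_alt:
  "is_coeffs M r chi c \<longleftrightarrow>
     (\<forall>u\<in>seqs M. complex_of_real (chi u) = mform M r c (\<lambda>_. u)) \<and>
     (\<forall>\<sigma>\<in>sgns r. \<forall>k\<in>tuples M r. c (\<lambda>j\<in>{..<r}. - \<sigma> j) k = cnj (c \<sigma> k)) \<and>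
     permutation_invariant M r c \<and>
     (\<forall>\<sigma> k. \<sigma> \<notin> sgns r \<or> k \<notin> tuples M r \<longrightarrow> c \<sigma> k = 0)"
  unfolding is_coeffs_def mform_def permutation_invariant_def by (rule refl)

lemma is_coeffs_unique:
  assumes c: "is_coeffs M r chi c" and c': "is_coeffs M r chi c'"
  shows "c = c'"
proof (intro ext)
  fix \<sigma> k
  let ?d = "\<lambda>\<sigma> k. c \<sigma> k - c' \<sigma> k"
  have diff: "mform M r ?d w = mform M r c w - mform M r c' w" for w
    by (simp add: mform_def algebra_simps sum_subtractf)
  have inv: "permutation_invariant M r ?d"
    using c c' by (simp add: is_coeffs_alt permutation_invariant_def)
  have zero: "mform M r ?d (\<lambda>_. u) = 0" if "u \<in> seqs M" for u
    using c c' that unfolding diff is_coeffs_alt by (metis diff_self)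
  have "mform M r ?d w = 0" if "\<And>j. w j \<in> seqs M" for w
    using mform_polarize [OF inv zero that] .
  from coeffs_eq_zero [of M r ?d, OF this, of \<sigma> k] show "c \<sigma> k = c' \<sigma> k"
    using c c' unfolding is_coeffs_alt by (cases "\<sigma> \<in> sgns r \<and> k \<in> tuples M r") auto
qed

lemma bij_betw_sgns_uminus: "bij_betw (\<lambda>\<sigma>. \<lambda>j\<in>{..<r}. - \<sigma> j) (sgns r) (sgns r)"
proof -
  have neg_neg: "(\<lambda>j\<in>{..<r}. - (\<lambda>j\<in>{..<r}. - \<sigma> j) j) = \<sigma>" if "\<sigma> \<in> sgns r" for \<sigma>
    using that by (auto simp: sgns_def fun_eq_iff PiE_def extensional_def)
  have neg: "(\<lambda>j\<in>{..<r}. - \<sigma> j) \<in> sgns r" if "\<sigma> \<in> sgns r" for \<sigma>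
    unfolding sgns_def
  proof (rule restrict_PiE_iff [THEN iffD2], rule ballI)
    fix j assume "j \<in> {..<r}"
    with that have "\<sigma> j \<in> {- 1, 1}"
      unfolding sgns_def by (rule PiE_mem)
    then show "- \<sigma> j \<in> {- 1, 1}" by auto
  qed
  show ?thesis
    by (rule bij_betw_byWitness [where f' = "\<lambda>\<sigma>. \<lambda>j\<in>{..<r}. - \<sigma> j"])
      (intro ballI image_subsetI neg neg_neg; assumption)+
qed

lemma mform_conj_coeffs:
  "mform M r (\<lambda>\<sigma> k. cnj (c (\<lambda>j\<in>{..<r}. - \<sigma> j) k)) w = cnj (mform M r c w)"
proof -
  have "conj_pow z (- s) = cnj (conj_pow z s)" if "s \<in> {- 1, 1}" for z s
    using that by (auto simp: conj_pow_def)
  then have "(\<Prod>j<r. conj_pow (Poly_Mapping.lookup (w j) (k j)) ((\<lambda>j\<in>{..<r}. - \<sigma> j) j))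
      = cnj (\<Prod>j<r. conj_pow (Poly_Mapping.lookup (w j) (k j)) (\<sigma> j))" if "\<sigma> \<in> sgns r" for \<sigma> k
    using that unfolding cnj_prod by (intro prod.cong refl) (auto simp: sgns_def PiE_iff)
  moreover have "mform M r c w = (\<Sum>\<sigma>\<in>sgns r. \<Sum>k\<in>tuples M r. c (\<lambda>j\<in>{..<r}. - \<sigma> j) k
      * (\<Prod>j<r. conj_pow (Poly_Mapping.lookup (w j) (k j)) ((\<lambda>j\<in>{..<r}. - \<sigma> j) j)))"
    unfolding mform_def by (rule sum.reindex_bij_betw [OF bij_betw_sgns_uminus, symmetric])
  ultimately show ?thesis
    by (simp add: mform_def)
qed

text \<open>
  Averaging over the permutations of the slots, and then over complex conjugation, does not change
  the values on the diagonal, since the latter are permutation invariant and real.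
\<close>

lemma is_coeffs_exists:
  assumes "is_form M r (\<lambda>u. complex_of_real (chi u))"
  shows "\<exists>c. is_coeffs M r chi c"
proof -
  obtain c0 where c0: "\<forall>u\<in>seqs M. complex_of_real (chi u) = mform M r c0 (\<lambda>_. u)"
    using assms unfolding is_form_def by (rule exE)
  define N where "N = (of_nat (fact r) :: complex)"
  define neg where "neg \<sigma> = (\<lambda>j\<in>{..<r}. - \<sigma> j)" for \<sigma> :: "nat \<Rightarrow> int"
  define c1 where "c1 \<sigma> k = (\<Sum>\<pi> | \<pi> permutes {..<r}. c0 (\<sigma> \<circ> \<pi>) (k \<circ> \<pi>)) / N" for \<sigma> k
  define c2 where "c2 \<sigma> k = (c1 \<sigma> k + cnj (c1 (neg \<sigma>) k)) / 2" for \<sigma> k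
  define c where "c \<sigma> k = (if \<sigma> \<in> sgns r \<and> k \<in> tuples M r then c2 \<sigma> k else 0)" for \<sigma> k
  have N: "N \<noteq> 0" by (simp add: N_def)
  have neg_sgns: "neg \<sigma> \<in> sgns r" if "\<sigma> \<in> sgns r" for \<sigma>
    using bij_betw_sgns_uminus that unfolding neg_def by (rule bij_betw_apply)
  have neg_neg: "neg (neg \<sigma>) = \<sigma>" if "\<sigma> \<in> sgns r" for \<sigma>
    using that by (auto simp: neg_def sgns_def fun_eq_iff PiE_def extensional_def)
  have neg_permute: "neg (\<sigma> \<circ> \<pi>) = neg \<sigma> \<circ> \<pi>" if "\<pi> permutes {..<r}" for \<sigma> \<pi>
    using permutes_in_image [OF that] by (auto simp: neg_def fun_eq_iff restrict_def)
  have c1_permute: "c1 (\<sigma> \<circ> \<rho>) (k \<circ> \<rho>) = c1 \<sigma> k" if "\<rho> permutes {..<r}" for \<sigma> k \<rho>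
    unfolding c1_def
    by (subst setum_permutations_compose_left [OF that, of "\<lambda>\<pi>. c0 (\<sigma> \<circ> \<pi>) (k \<circ> \<pi>)"]) (simp add: comp_assoc)
  have c1_form: "mform M r c1 (\<lambda>_. u) = mform M r c0 (\<lambda>_. u)" for u
  proof -
    have "mform M r c1 (\<lambda>_. u)
        = (\<Sum>\<pi> | \<pi> permutes {..<r}. mform M r (\<lambda>\<sigma> k. c0 (\<sigma> \<circ> \<pi>) (k \<circ> \<pi>)) (\<lambda>_. u)) / N"
      unfolding mform_def c1_def
      by (subst sum.swap, subst (2) sum.swap)
        (simp add: sum_distrib_right sum_divide_distrib)
    also have "\<dots> = (\<Sum>\<pi> | \<pi> permutes {..<r}. mform M r c0 (\<lambda>_. u)) / N"
    proof -
      have "mform M r (\<lambda>\<sigma> k. c0 (\<sigma> \<circ> \<pi>) (k \<circ> \<pi>)) (\<lambda>_. u) = mform M r c0 (\<lambda>_. u)"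
        if "\<pi> permutes {..<r}" for \<pi>
        using mform_permute_coeffs [OF that, of M c0 "\<lambda>_. u"] by (simp only: o_def)
      then show ?thesis
        by (intro arg_cong2 [where f = "(/)"] sum.cong refl) auto
    qed
    also have "\<dots> = mform M r c0 (\<lambda>_. u)"
      using N by (simp add: card_permutations [of "{..<r}" r] N_def)
    finally show ?thesis .
  qed
  have c2_form: "mform M r c2 w = (mform M r c1 w + cnj (mform M r c1 w)) / 2" for w
    unfolding mform_conj_coeffs [symmetric] unfolding mform_def c2_def neg_def
    by (simp add: sum.distrib [symmetric] sum_divide_distrib algebra_simps add_divide_distrib)
  have "complex_of_real (chi u) = mform M r c2 (\<lambda>_. u)" if "u \<in> seqs M" for u
    unfolding c2_form c1_form c0 [rule_format, OF that, symmetric] by simp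
  moreover have "mform M r c2 w = mform M r c w" for w
    unfolding mform_def c_def by (intro sum.cong refl) simp
  moreover have "c (neg \<sigma>) k = cnj (c \<sigma> k)" if "\<sigma> \<in> sgns r" "k \<in> tuples M r" for \<sigma> k
    using that neg_sgns by (simp add: c_def c2_def neg_neg add.commute)
  moreover have "permutation_invariant M r c"
    unfolding permutation_invariant_def
  proof (intro ballI allI impI)
    fix \<sigma> k \<pi> assume \<sigma>: "\<sigma> \<in> sgns r" and k: "k \<in> tuples M r" and \<pi>: "\<pi> permutes {..<r}"
    have "\<sigma> \<circ> \<pi> \<in> sgns r"
      using \<sigma> unfolding sgns_def by (rule bij_betw_apply [OF bij_betw_PiE_permute [OF \<pi>]])
    moreover have "k \<circ> \<pi> \<in> tuples M r"
      using k unfolding tuples_def by (rule bij_betw_apply [OF bij_betw_PiE_permute [OF \<pi>]])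
    ultimately show "c (\<sigma> \<circ> \<pi>) (k \<circ> \<pi>) = c \<sigma> k"
      using \<sigma> k \<pi> by (simp add: c_def c2_def neg_permute c1_permute)
  qed
  ultimately have "is_coeffs M r chi c"
    unfolding is_coeffs_alt neg_def by (auto simp: c_def)
  then show ?thesis
    by (rule exI [of _ c])
qed

lemma is_coeffs_coeffs:
  assumes "chi \<in> homog_polys M r"
  shows "is_coeffs M r chi (coeffs M r chi)"
  unfolding coeffs_def
  using is_coeffs_exists [OF homog_polys_is_form [OF assms]] is_coeffs_unique
  by (metis theI)

section \<open>The gradient and its differential\<close>

lemma has_derivative_within_subspace_unique:
  assumes S: "subspace S" "u \<in> S" "h \<in> S"
    and f: "(f has_derivative F) (at u within S)" "(f has_derivative F') (at u within S)"
  shows "F h = F' h"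
proof -
  let ?l = "\<lambda>t :: real. u + t *\<^sub>R h"
  have l: "(?l has_derivative (\<lambda>t. t *\<^sub>R h)) (at 0)"
    by (auto intro!: derivative_eq_intros)
  have "range ?l \<subseteq> S"
    using S by (auto intro: subspace_add subspace_scale)
  then have "(f has_derivative F) (at (?l 0) within range ?l)"
    "(f has_derivative F') (at (?l 0) within range ?l)"
    using f by (auto intro: has_derivative_subset)
  from this [THEN has_derivative_in_compose [OF l]]
  have "(\<lambda>t. F (t *\<^sub>R h)) = (\<lambda>t. F' (t *\<^sub>R h))"
    by (rule has_derivative_unique)
  from fun_cong [OF this, of 1] show ?thesis by simp
qed

text \<open>
  The Riesz representative of a real linear functional; its real and imaginary parts at \<open>k\<close> are the
  values at the two real unit vectors of mode \<open>k\<close>.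
\<close>

definition riesz :: "real \<Rightarrow> (cseq \<Rightarrow> real) \<Rightarrow> cseq" where
  "riesz M D = (\<Sum>k\<in>modes M. D (Poly_Mapping.single k 1) *\<^sub>R Poly_Mapping.single k 1
     + D (Poly_Mapping.single k \<i>) *\<^sub>R Poly_Mapping.single k \<i>)"

lemma lookup_riesz:
  assumes "k \<in> modes M"
  shows "Poly_Mapping.lookup (riesz M D) k
    = Complex (D (Poly_Mapping.single k 1)) (D (Poly_Mapping.single k \<i>))"
proof -
  have "Poly_Mapping.lookup (riesz M D) k = (\<Sum>m\<in>modes M. if k = m then
      Complex (D (Poly_Mapping.single m 1)) (D (Poly_Mapping.single m \<i>)) else 0)"
    unfolding riesz_def lookup_sum
    by (intro sum.cong refl) (auto simp: lookup_add lookup_single complex_eq_iff)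
  then show ?thesis
    using assms by (simp add: finite_modes)
qed

lemma riesz_in_seqs: "riesz M D \<in> seqs M"
  unfolding riesz_def
  by (intro subspace_sum subspace_add subspace_scale subspace_seqs single_in_seqs)

lemma scal_alt: "scal M g h = (\<Sum>k\<in>modes M. Re (Poly_Mapping.lookup g k) * Re (Poly_Mapping.lookup h k)
    + Im (Poly_Mapping.lookup g k) * Im (Poly_Mapping.lookup h k))"
  by (simp add: scal_def)

lemma scal_riesz:
  assumes "linear D" "h \<in> seqs M"
  shows "scal M (riesz M D) h = D h"
  unfolding scal_alt linear_on_seqs [OF assms]
  by (intro sum.cong refl) (simp add: lookup_riesz)

lemma riesz_scal:
  assumes "g \<in> seqs M"
  shows "riesz M (scal M g) = g"
proof (rule poly_mapping_eqI)
  fix k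
  show "Poly_Mapping.lookup (riesz M (scal M g)) k = Poly_Mapping.lookup g k"
  proof (cases "k \<in> modes M")
    case True
    have "scal M g (Poly_Mapping.single k z)
        = (\<Sum>m\<in>modes M. if k = m then Re (Poly_Mapping.lookup g m) * Re z + Im (Poly_Mapping.lookup g m) * Im z else 0)" for z
      unfolding scal_alt by (intro sum.cong refl) (auto simp: lookup_single)
    then show ?thesis
      using True by (simp add: lookup_riesz finite_modes)
  next
    case False
    then show ?thesis
      using assms riesz_in_seqs [of M "scal M g"] unfolding seqs_def
      by (metis in_keys_iff mem_Collect_eq subsetD)
  qed
qed

text \<open>
  Duality of \<open>h^(1/2)\<close> and \<open>h^(-1/2)\<close>: test with \<open>h = \<langle>\<ell>\<rangle> g\<close>.
\<close>

lemma hnorm_half_le_dual: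
  assumes g: "g \<in> seqs M" and B: "0 \<le> B"
    and le: "\<And>h. h \<in> seqs M \<Longrightarrow> scal M g h \<le> B * hnorm M (- 1/2) h"
  shows "hnorm M (1/2) g \<le> B"
proof -
  define h where "h = (\<Sum>k\<in>modes M. wt k *\<^sub>R Poly_Mapping.single k (Poly_Mapping.lookup g k))"
  have h: "h \<in> seqs M"
    unfolding h_def by (intro subspace_sum subspace_scale subspace_seqs single_in_seqs)
  have lookup_h: "Poly_Mapping.lookup h k = wt k *\<^sub>R Poly_Mapping.lookup g k" if "k \<in> modes M" for k
  proof -
    have "Poly_Mapping.lookup h k = (\<Sum>m\<in>modes M. if k = m then wt m *\<^sub>R Poly_Mapping.lookup g m else 0)"
      unfolding h_def lookup_sum by (intro sum.cong refl) (auto simp: lookup_single)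
    then show ?thesis using that by (simp add: finite_modes)
  qed
  have "(hnorm M (1/2) g)\<^sup>2 = (\<Sum>k\<in>modes M. wt k * (cmod (Poly_Mapping.lookup g k))\<^sup>2)"
    unfolding hnorm_def by (simp add: sum_nonneg)
  also have "\<dots> = scal M g h"
    unfolding scal_alt
    by (intro sum.cong refl) (simp add: lookup_h cmod_power2, simp add: algebra_simps power2_eq_square)
  finally have scal: "(hnorm M (1/2) g)\<^sup>2 = scal M g h" .
  have "hnorm M (- 1/2) h = hnorm M (1/2) g"
    unfolding hnorm_minus_half hnorm_half
  proof (rule L2_set_cong [OF refl])
    fix k assume "k \<in> modes M"
    moreover have "wt k = sqrt (wt k) * sqrt (wt k)"
      by simp
    ultimately show "cmod (Poly_Mapping.lookup h k) / sqrt (wt k) = sqrt (wt k) * cmod (Poly_Mapping.lookup g k)"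
      using jap_pos [of "real (fst k)"] by (simp add: lookup_h divide_eq_eq mult_ac)
  qed
  with le [OF h] scal have "hnorm M (1/2) g * hnorm M (1/2) g \<le> B * hnorm M (1/2) g"
    by (simp add: power2_eq_square)
  then show ?thesis
    using B hnorm_nonneg [of M "1/2" g] by (cases "hnorm M (1/2) g = 0") auto
qed

lemma Cnorm_ge:
  assumes "\<sigma> \<in> sgns r" "k \<in> tuples M r"
  shows "cmod (coeffs M r chi \<sigma> k) * jap (\<Sum>j<r. real_of_int (\<sigma> j) * real (fst (k j)))
    * sqrt (\<Prod>j<r. wt (k j)) * sqrt (Upsilon r k) \<le> Cnorm M r chi"
  unfolding Cnorm_def
  using assms finite_sgns finite_tuples by (intro Max_ge) (auto intro!: rev_image_eqI [of "(\<sigma>, k)"])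

lemma Cnorm_nonneg:
  assumes "0 \<le> M"
  shows "0 \<le> Cnorm M r chi"
proof -
  have "(\<lambda>j\<in>{..<r}. 1) \<in> sgns r" "(\<lambda>j\<in>{..<r}. (0, 0)) \<in> tuples M r"
    using assms by (auto simp: sgns_def tuples_def modes_def)
  from Cnorm_ge [OF this] show ?thesis
    by (rule order_trans [rotated]) (intro mult_nonneg_nonneg real_sqrt_ge_zero prod_nonneg; use Upsilon_ge_1 in \<open>auto intro: order_trans [OF zero_le_one]\<close>)
qed

definition dform :: "real \<Rightarrow> nat \<Rightarrow> ((nat \<Rightarrow> int) \<Rightarrow> (nat \<Rightarrow> mode) \<Rightarrow> complex) \<Rightarrow> cseq \<Rightarrow> cseq \<Rightarrow> real" where
  "dform M r c u h = (\<Sum>i<r. Re (mform M r c ((\<lambda>_. u)(i := h))))"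

definition ddform :: "real \<Rightarrow> nat \<Rightarrow> ((nat \<Rightarrow> int) \<Rightarrow> (nat \<Rightarrow> mode) \<Rightarrow> complex) \<Rightarrow> cseq \<Rightarrow> cseq \<Rightarrow> cseq \<Rightarrow> real" where
  "ddform M r c u v h = (\<Sum>i<r. \<Sum>j\<in>{..<r} - {i}. Re (mform M r c ((\<lambda>_. u)(j := v, i := h))))"

lemma linear_Re_mform_slot: "i < r \<Longrightarrow> linear (\<lambda>h. Re (mform M r c (w(i := h))))"
  using linear_compose [OF linear_mform_slot bounded_linear.linear [OF bounded_linear_Re]]
  by (simp add: o_def)

lemma linear_dform: "linear (dform M r c u)"
  unfolding dform_def by (intro linear_compose_sum ballI linear_Re_mform_slot) simp

lemma linear_ddform: "linear (ddform M r c u v)"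
  unfolding ddform_def by (intro linear_compose_sum ballI linear_Re_mform_slot) simp

lemma mform_diagonal_has_derivative:
  "((\<lambda>u. Re (mform M r c (\<lambda>_. u))) has_derivative dform M r c u) (at u within S)"
  unfolding dform_def Re_sum [symmetric]
  by (intro has_derivative_Re mform_has_derivative has_derivative_ident)

lemma dform_has_derivative:
  "((\<lambda>u. dform M r c u h) has_derivative (\<lambda>v. ddform M r c u v h)) (at u within S)"
  unfolding dform_def ddform_def
proof (rule has_derivative_sum)
  fix i assume "i \<in> {..<r}"
  define w' where "w' j v = (if j = i then 0 else v)" for j :: nat and v :: cseq
  have "((\<lambda>u. Re (mform M r c ((\<lambda>_. u)(i := h)))) has_derivative
      (\<lambda>v. Re (\<Sum>j<r. mform M r c (((\<lambda>_. u)(i := h))(j := w' j v))))) (at u within S)"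
  proof (intro has_derivative_Re mform_has_derivative)
    show "((\<lambda>x. ((\<lambda>_. x)(i := h)) j) has_derivative w' j) (at u within S)" for j
    proof (cases "j = i")
      case True
      then have "w' j = (\<lambda>_. 0)" by (auto simp: w'_def)
      then show ?thesis using True by simp
    next
      case False
      then have "w' j = (\<lambda>v. v)" by (auto simp: w'_def)
      then show ?thesis using False by simp
    qed
  qed
  moreover have "(\<Sum>j<r. mform M r c (((\<lambda>_. u)(i := h))(j := w' j v)))
      = (\<Sum>j\<in>{..<r} - {i}. mform M r c ((\<lambda>_. u)(j := v, i := h)))" for v
  proof -
    have "mform M r c (((\<lambda>_. u)(i := h))(i := w' i v)) = 0"
      using \<open>i \<in> {..<r}\<close> linear_0 [OF linear_mform_slot [of i r M c "(\<lambda>_. u)(i := h)"]]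
      by (simp add: w'_def)
    then have "(\<Sum>j<r. mform M r c (((\<lambda>_. u)(i := h))(j := w' j v)))
        = (\<Sum>j\<in>{..<r} - {i}. mform M r c (((\<lambda>_. u)(i := h))(j := w' j v)))"
      using \<open>i \<in> {..<r}\<close> by (simp add: sum.remove [of "{..<r}" i])
    also have "\<dots> = (\<Sum>j\<in>{..<r} - {i}. mform M r c ((\<lambda>_. u)(j := v, i := h)))"
      by (intro sum.cong refl) (auto simp: w'_def fun_upd_twist)
    finally show ?thesis .
  qed
  ultimately show "((\<lambda>u. Re (mform M r c ((\<lambda>_. u)(i := h)))) has_derivative
      (\<lambda>v. \<Sum>j\<in>{..<r} - {i}. Re (mform M r c ((\<lambda>_. u)(j := v, i := h))))) (at u within S)"
    by simp
qed

text \<open>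
  A derivative within a subspace may be modified off that subspace. This reconciles the derivative of
  \<open>chi\<close> with the functional \<open>scal M g\<close>, as they are only compared on \<open>seqs M\<close>.
\<close>

lemma has_derivative_within_subspace_cong:
  assumes S: "subspace S" "u \<in> S"
    and f: "(f has_derivative F) (at u within S)"
    and F': "bounded_linear F'" "\<And>h. h \<in> S \<Longrightarrow> F' h = F h"
  shows "(f has_derivative F') (at u within S)"
proof -
  have "((\<lambda>y. (1 / norm (y - u)) *\<^sub>R (f y - (f u + F' (y - u)))) \<longlongrightarrow> 0) (at u within S)
      \<longleftrightarrow> ((\<lambda>y. (1 / norm (y - u)) *\<^sub>R (f y - (f u + F (y - u)))) \<longlongrightarrow> 0) (at u within S)"
    by (rule Lim_cong_within) (simp_all add: F'(2) subspace_diff S)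
  then show ?thesis
    using f F'(1) by (simp add: has_derivative_within)
qed

lemma bounded_linear_scal: "bounded_linear (scal M g)"
  unfolding scal_alt [abs_def]
  by (intro bounded_linear_sum bounded_linear_add bounded_linear_const_mult
      bounded_linear_compose [OF bounded_linear_Re bounded_linear_lookup]
      bounded_linear_compose [OF bounded_linear_Im bounded_linear_lookup])

lemma nabla_eq_riesz:
  assumes chi: "\<And>u. u \<in> seqs M \<Longrightarrow> complex_of_real (chi u) = mform M r c (\<lambda>_. u)"
    and u: "u \<in> seqs M"
  shows "nabla M chi u = riesz M (dform M r c u)"
  unfolding nabla_def
proof (rule the_equality)
  have chi': "(chi has_derivative dform M r c u) (at u within seqs M)"
  proof (rule has_derivative_transform [OF u _ mform_diagonal_has_derivative])
    show "chi x = Re (mform M r c (\<lambda>_. x))" if "x \<in> seqs M" for x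
      using chi [OF that] by (metis Re_complex_of_real)
  qed
  have unique: "scal M g h = dform M r c u h"
    if "(chi has_derivative scal M g) (at u within seqs M)" "h \<in> seqs M" for g h
    using has_derivative_within_subspace_unique [OF subspace_seqs u that(2) that(1) chi'] .
  show "riesz M (dform M r c u) \<in> seqs M \<and>
      (chi has_derivative (\<lambda>h. scal M (riesz M (dform M r c u)) h)) (at u within seqs M)"
    using chi' riesz_in_seqs
    by (intro conjI has_derivative_within_subspace_cong [OF subspace_seqs u _ bounded_linear_scal])
      (auto simp: scal_riesz linear_dform)
  fix g assume g: "g \<in> seqs M \<and> (chi has_derivative (\<lambda>h. scal M g h)) (at u within seqs M)"
  then have "riesz M (scal M g) = riesz M (dform M r c u)"
    unfolding riesz_def by (intro sum.cong refl) (simp add: unique single_in_seqs)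
  then show "g = riesz M (dform M r c u)"
    using g riesz_scal by simp
qed

lemma nabla_has_derivative:
  assumes "\<And>u. u \<in> seqs M \<Longrightarrow> complex_of_real (chi u) = mform M r c (\<lambda>_. u)" "u \<in> seqs M"
  shows "(nabla M chi has_derivative (\<lambda>v. riesz M (ddform M r c u v))) (at u within seqs M)"
proof (rule has_derivative_transform [OF assms(2)])
  show "nabla M chi x = riesz M (dform M r c x)" if "x \<in> seqs M" for x
    using assms(1) that by (rule nabla_eq_riesz)
  show "((\<lambda>x. riesz M (dform M r c x)) has_derivative (\<lambda>v. riesz M (ddform M r c u v))) (at u within seqs M)"
    unfolding riesz_def
    by (intro has_derivative_sum has_derivative_add has_derivative_scaleR_left dform_has_derivative)
qed

lemma dnabla_eq_riesz:
  assumes "\<And>u. u \<in> seqs M \<Longrightarrow> complex_of_real (chi u) = mform M r c (\<lambda>_. u)" "u \<in> seqs M" "v \<in> seqs M"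
  shows "dnabla M chi u v = riesz M (ddform M r c u v)"
proof -
  have *: "(nabla M chi has_derivative (\<lambda>v. riesz M (ddform M r c u v))) (at u within seqs M)"
    using assms(1,2) by (rule nabla_has_derivative)
  then have "(nabla M chi has_derivative dnabla M chi u) (at u within seqs M)"
    unfolding dnabla_def using frechet_derivative_works differentiable_def by blast
  then show ?thesis
    using has_derivative_within_subspace_unique [OF subspace_seqs assms(2,3) _ *] by blast
qed

section \<open>The estimate\<close>

theorem lemma4p6:
  fixes r :: nat
  assumes "r \<ge> 2"
  shows "\<exists>c>0. \<forall>M::real. M \<ge> 2 \<longrightarrow> (\<forall>chi\<in>homog_polys M r. \<forall>u\<in>seqs M.
           hnorm M (1/2) (nabla M chi u)
             \<le> c * (ln M) powr ((real r - 1) / 2) * Cnorm M r chi * hnorm M (1/2) u ^ (r - 1) \<and>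
           hopnorm M (1/2) (dnabla M chi u)
             \<le> c * (ln M) powr ((real r - 1) / 2) * Cnorm M r chi * hnorm M (1/2) u ^ (r - 2))"
proof (intro exI conjI allI impI ballI)
  define C where "C = real r * real r * (2 ^ r * ((5 + real r) * sqrt 12 ^ (r - 1)))"
  show "0 < C"
    using assms by (simp add: C_def)
  fix M :: real and chi u
  assume M: "M \<ge> 2" and chi: "chi \<in> homog_polys M r" and u: "u \<in> seqs M"
  define c where "c = coeffs M r chi"
  define K where "K = Cnorm M r chi"
  define L where "L = sqrt (12 * ln M)"
  define U where "U = hnorm M (1/2) u"
  have form: "complex_of_real (chi u) = mform M r c (\<lambda>_. u)" if "u \<in> seqs M" for u
    using is_coeffs_coeffs [OF chi] that unfolding is_coeffs_alt c_def by blast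
  have K: "0 \<le> K"
    using M by (simp add: K_def Cnorm_nonneg)
  have L: "0 \<le> L" and U: "0 \<le> U"
    using M by (simp_all add: L_def U_def hnorm_nonneg)
  have Re_mform_le: "Re (mform M r c w) \<le> 2 ^ r * (K * ((5 + real r) * hnorm M (- 1/2) (w i)
      * (\<Prod>j\<in>{..<r} - {i}. L * hnorm M (1/2) (w j))))" if "i < r" for w i
  proof -
    have "cmod (mform M r c w) \<le> 2 ^ r * (K * ((5 + real r) * hnorm M (- 1/2) (w i)
      * (\<Prod>j\<in>{..<r} - {i}. L * hnorm M (1/2) (w j))))"
      unfolding L_def using M that K
      by (rule cmod_mform_le) (auto simp: c_def K_def intro: Cnorm_ge)
    then show ?thesis
      using complex_Re_le_cmod order_trans by blast
  qed
  have "L ^ (r - 1) = sqrt 12 ^ (r - 1) * ln M powr ((real r - 1) / 2)"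
  proof -
    have "0 < ln M" using M by simp
    then have "sqrt (ln M) ^ (r - 1) = ln M powr ((real r - 1) / 2)"
      using assms by (simp add: powr_half_sqrt [symmetric] powr_realpow [symmetric] powr_powr of_nat_diff)
    then show ?thesis
      by (simp add: L_def real_sqrt_mult power_mult_distrib)
  qed
  then have C: "C * ln M powr ((real r - 1) / 2) = real r * real r * (2 ^ r * ((5 + real r) * L ^ (r - 1)))"
    by (simp add: C_def)
  define B where "B n = C * ln M powr ((real r - 1) / 2) * K * U ^ n" for n
  have B_nonneg: "0 \<le> B n" for n
    unfolding B_def using \<open>0 < C\<close> K U by simp
  \<comment> \<open>A spare factor \<open>r\<close> is spent so that both estimates share the constant \<open>C\<close>.\<close>
  have dform_le: "dform M r c u h \<le> B (r - 1) * hnorm M (- 1/2) h" for h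
  proof -
    have "Re (mform M r c ((\<lambda>_. u)(i := h)))
        \<le> 2 ^ r * (K * ((5 + real r) * hnorm M (- 1/2) h * (L * U) ^ (r - 1)))" if "i < r" for i
      using Re_mform_le [OF that, of "(\<lambda>_. u)(i := h)"] that
      by (simp add: U_def cong: prod.cong_simp)
    then have "dform M r c u h
        \<le> (\<Sum>i<r. 2 ^ r * (K * ((5 + real r) * hnorm M (- 1/2) h * (L * U) ^ (r - 1))))"
      unfolding dform_def by (intro sum_mono) simp
    also have "\<dots> = 1 * (real r * (2 ^ r * (K * ((5 + real r) * hnorm M (- 1/2) h * (L * U) ^ (r - 1)))))"
      by simp
    also have "\<dots> \<le> real r * (real r * (2 ^ r * (K * ((5 + real r) * hnorm M (- 1/2) h * (L * U) ^ (r - 1)))))"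
      using assms K L U by (intro mult_right_mono mult_nonneg_nonneg) (auto simp: hnorm_nonneg)
    finally show ?thesis
      unfolding B_def C by (simp add: power_mult_distrib mult_ac)
  qed
  have ddform_le: "ddform M r c u v h \<le> B (r - 2) * hnorm M (1/2) v * hnorm M (- 1/2) h" for v h
  proof -
    define T where "T = 2 ^ r * (K * ((5 + real r) * hnorm M (- 1/2) h * (L ^ (r - 1) * (hnorm M (1/2) v * U ^ (r - 2)))))"
    have T: "0 \<le> T"
      unfolding T_def using K L U by (intro mult_nonneg_nonneg) (auto simp: hnorm_nonneg)
    \<comment> \<open>The slot of \<open>h\<close> is the distinguished one, so that \<open>v\<close> costs a logarithmic factor \<open>L\<close> like each of
      the \<open>r - 2\<close> copies of \<open>u\<close>.\<close>
    have "Re (mform M r c ((\<lambda>_. u)(j := v, i := h))) \<le> T" if "i < r" "j \<in> {..<r} - {i}" for i j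
    proof -
      let ?w = "(\<lambda>_. u)(j := v, i := h)"
      have "(\<Prod>l\<in>{..<r} - {i} - {j}. L * hnorm M (1/2) (?w l)) = (\<Prod>l\<in>{..<r} - {i} - {j}. L * U)"
        by (intro prod.cong) (auto simp: U_def)
      also have "\<dots> = (L * U) ^ (r - 2)"
        using that by (simp add: card_Diff_singleton_if numeral_2_eq_2)
      finally have "(\<Prod>l\<in>{..<r} - {i}. L * hnorm M (1/2) (?w l)) = L * hnorm M (1/2) v * (L * U) ^ (r - 2)"
        using that by (simp add: prod.remove [of "{..<r} - {i}" j])
      also have "\<dots> = L ^ (r - 1) * (hnorm M (1/2) v * U ^ (r - 2))"
      proof -
        have "r - 1 = Suc (r - 2)" using assms by simp
        then show ?thesis by (simp add: power_mult_distrib)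
      qed
      finally show ?thesis
        using Re_mform_le [OF that(1), of ?w] by (simp add: T_def)
    qed
    then have "ddform M r c u v h \<le> (\<Sum>i<r. \<Sum>j\<in>{..<r} - {i}. T)"
      unfolding ddform_def by (intro sum_mono) simp
    also have "\<dots> \<le> (\<Sum>i<r. \<Sum>j<r. T)"
      using T by (intro sum_mono sum_mono2) auto
    also have "\<dots> = B (r - 2) * hnorm M (1/2) v * hnorm M (- 1/2) h"
      unfolding B_def C T_def by (simp add: mult_ac)
    finally show ?thesis .
  qed
  have nabla: "nabla M chi u = riesz M (dform M r c u)"
    using form u by (rule nabla_eq_riesz)
  have "hnorm M (1/2) (nabla M chi u) \<le> B (r - 1)"
    unfolding nabla
    by (rule hnorm_half_le_dual [OF riesz_in_seqs B_nonneg]) (simp only: scal_riesz [OF linear_dform] dform_le)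
  then show "hnorm M (1/2) (nabla M chi u)
      \<le> C * ln M powr ((real r - 1) / 2) * Cnorm M r chi * hnorm M (1/2) u ^ (r - 1)"
    by (simp add: B_def K_def U_def)
  have "hopnorm M (1/2) (dnabla M chi u) \<le> B (r - 2)"
    unfolding hopnorm_def
  proof (rule cSUP_least)
    show "seqs M \<noteq> {}"
      using u by blast
    fix v assume v: "v \<in> seqs M"
    have dnabla: "dnabla M chi u v = riesz M (ddform M r c u v)"
      using form u v by (rule dnabla_eq_riesz)
    have "hnorm M (1/2) (dnabla M chi u v) \<le> B (r - 2) * hnorm M (1/2) v"
      unfolding dnabla
      by (rule hnorm_half_le_dual [OF riesz_in_seqs mult_nonneg_nonneg [OF B_nonneg hnorm_nonneg]])
        (simp only: scal_riesz [OF linear_ddform] ddform_le)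
    then show "hnorm M (1/2) (dnabla M chi u v) / hnorm M (1/2) v \<le> B (r - 2)"
      using B_nonneg hnorm_nonneg [of M "1/2" v]
      by (cases "hnorm M (1/2) v = 0") (auto simp: divide_le_eq)
  qed
  then show "hopnorm M (1/2) (dnabla M chi u)
      \<le> C * ln M powr ((real r - 1) / 2) * Cnorm M r chi * hnorm M (1/2) u ^ (r - 2)"
    by (simp add: B_def K_def U_def)
qed

end
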